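(* Let $(X,T)$ be a dynamical system with the shadowing property and let $\mu\in M_T(X)$. If $\operatorname{supp}(\mu)/_\sim$ is a singleton (i.e. $\operatorname{supp}(\mu)$ is contained in a single chain-recurrent class of $(X,T)$), then for every $\varepsilon>0$ there is an ergodic measure $\nu\in M_T(X)$ supported on an odometer such that $d_{\mathrm{BL}}(\nu,\mu)<\varepsilon$.
   Context: A dynamical system $(X,T)$ is a compact metric space $(X,d)$ with a continuous map $T\colon X\to X$ (not necessarily invertible). A sequence $(x_n)_{n=0}^\infty$ in $X$ is a $\delta$-pseudo-orbit if $d(T(x_n),x_{n+1})<\delta$ for all $n\ge 0$; it is $\varepsilon$-traced by $y\in X$ if $d(T^n(y),x_n)<\varepsilon$ for all $n\ge 0$. $(X,T)$ has the shadowing property if for every $\varepsilon>0$ there is $\delta>0$ such that every $\delta$-pseudo-orbit is $\varepsilon$-traced by some point of $X$. A $\delta$-chain of length $n\geq 1$ from $x$ to $y$ is a finite sequence $x=x_0,x_1,\dots,x_n=y$ in $X$ with $d(T(x_i),x_{i+1})<\delta$ for $0\le i<n$. Write $x\sim y$ if for every $\delta>0$ there are a $\delta$-chain from $x$ to $y$ and a $\delta$-chain from $y$ to $x$. The relation $\sim$ is an equivalence relation on the set of chain recurrent points $\{x\colon x\sim x\}$; its classes are the chain-recurrent classes. $M_T(X)$ is the set of $T$-invariant Borel probability measures; $\operatorname{supp}(\mu)$ is the smallest closed set of $\mu$-measure $1$. Fix a countable sequence $(f_n)_{n\ge1}$ dense (in the supremum norm) in $\{f\colon X\to\mathbb{R}\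 \text{Lipschitz},\ \|f\|_\infty+\|f\|_L\le 1\}$, where $\|f\|_L$ is the least Lipschitz constant, and put $d_{\mathrm{BL}}(\mu,\nu)=\sum_{n=1}^\infty 2^{-n}\bigl|\int f_n\,d\mu-\int f_n\,d\nu\bigr|$; this metric induces the weak$^*$-topology on Borel probability measures. A point $x$ is regularly recurrent if for every open neighborhood $U$ of $x$ there is $k\ge 1$ with $T^{kn}(x)\in U$ for all $n\ge 0$. A system is equicontinuous if for every $\varepsilon>0$ there is $\delta>0$ such that $d(x,y)<\delta$ implies $d(T^n(x),T^n(y))<\varepsilon$ for all $n\ge 0$. An odometer is an equicontinuous system containing a regularly recurrent point with dense (forward) orbit (periodic orbits are odometers). A measure $\nu$ is supported on an odometer if there is a closed set $Z\subset X$ with $T(Z)\subset Z$ and $\nu(Z)=1$ such that $(Z,T|_Z)$ is an odometer. *)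

theory Defs
  imports "HOL-Probability.Probability"
begin

section \<open>Dynamical systems on compact metric spaces\<close>

text \<open>The space is a subset \<open>X\<close> of a metric type, with the induced metric, and \<open>T\<close> is
  a function on the whole type of which only the values on \<open>X\<close> matter.  Hence the restriction of
  the system to a closed forward invariant set \<open>Z\<close> is given by the same \<open>T\<close> with carrier \<open>Z\<close>.\<close>

definition dynamical_system :: "'a::metric_space set \<Rightarrow> ('a \<Rightarrow> 'a) \<Rightarrow> bool" where
  "dynamical_system X T \<longleftrightarrow> compact X \<and> continuous_on X T \<and> T ` X \<subseteq> X"

definition pseudo_orbit :: "'a::metric_space set \<Rightarrow> ('a \<Rightarrow> 'a) \<Rightarrow> real \<Rightarrow> (nat \<Rightarrow> 'a) \<Rightarrow> bool" where
  "pseudo_orbit X T \<delta> x \<longleftrightarrow> (\<forall>n. x n \<in> X) \<and> (\<forall>n. dist (T (x n)) (x (Suc n)) < \<delta>)"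

definition traced_by :: "('a::metric_space \<Rightarrow> 'a) \<Rightarrow> real \<Rightarrow> (nat \<Rightarrow> 'a) \<Rightarrow> 'a \<Rightarrow> bool" where
  "traced_by T \<epsilon> x y \<longleftrightarrow> (\<forall>n. dist ((T ^^ n) y) (x n) < \<epsilon>)"

definition shadowing_property :: "'a::metric_space set \<Rightarrow> ('a \<Rightarrow> 'a) \<Rightarrow> bool" where
  "shadowing_property X T \<longleftrightarrow>
     (\<forall>\<epsilon>>0. \<exists>\<delta>>0. \<forall>x. pseudo_orbit X T \<delta> x \<longrightarrow> (\<exists>y\<in>X. traced_by T \<epsilon> x y))"

definition chain :: "'a::metric_space set \<Rightarrow> ('a \<Rightarrow> 'a) \<Rightarrow> real \<Rightarrow> nat \<Rightarrow> (nat \<Rightarrow> 'a) \<Rightarrow> 'a \<Rightarrow> 'a \<Rightarrow> bool"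
  where
  "chain X T \<delta> n c x y \<longleftrightarrow> 1 \<le> n \<and> c 0 = x \<and> c n = y \<and>
     (\<forall>i\<le>n. c i \<in> X) \<and> (\<forall>i<n. dist (T (c i)) (c (Suc i)) < \<delta>)"

definition chain_related :: "'a::metric_space set \<Rightarrow> ('a \<Rightarrow> 'a) \<Rightarrow> 'a \<Rightarrow> 'a \<Rightarrow> bool" where
  "chain_related X T x y \<longleftrightarrow>
     (\<forall>\<delta>>0. (\<exists>n c. chain X T \<delta> n c x y) \<and> (\<exists>n c. chain X T \<delta> n c y x))"

definition chain_recurrent_set :: "'a::metric_space set \<Rightarrow> ('a \<Rightarrow> 'a) \<Rightarrow> 'a set" where
  "chain_recurrent_set X T = {x \<in> X. chain_related X T x x}"

definition chain_recurrent_classes :: "'a::metric_space set \<Rightarrow> ('a \<Rightarrow> 'a) \<Rightarrow> 'a set set" where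
  "chain_recurrent_classes X T =
     chain_recurrent_set X T // {(x, y). chain_related X T x y}"

section \<open>Invariant measures\<close>

text \<open>Borel measures on \<open>X\<close> are measures on \<open>restrict_space borel X\<close>, the Borel
  \<open>\<sigma>\<close>-algebra of the subspace \<open>X\<close>; in particular their space is \<open>X\<close>.\<close>

definition invariant_measures :: "'a::metric_space set \<Rightarrow> ('a \<Rightarrow> 'a) \<Rightarrow> 'a measure set" where
  "invariant_measures X T =
     {\<mu>. sets \<mu> = sets (restrict_space borel X) \<and> prob_space \<mu> \<and>
         (\<forall>A\<in>sets \<mu>. emeasure \<mu> (T -` A \<inter> X) = emeasure \<mu> A)}"

definition ergodic_measure :: "'a::metric_space set \<Rightarrow> ('a \<Rightarrow> 'a) \<Rightarrow> 'a measure \<Rightarrow> bool" where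
  "ergodic_measure X T \<mu> \<longleftrightarrow> \<mu> \<in> invariant_measures X T \<and>
     (\<forall>A\<in>sets \<mu>. T -` A \<inter> X = A \<longrightarrow> emeasure \<mu> A = 0 \<or> emeasure \<mu> A = 1)"

definition support :: "'a::metric_space set \<Rightarrow> 'a measure \<Rightarrow> 'a set" where
  "support X \<mu> = \<Inter>{C. closed C \<and> C \<subseteq> X \<and> emeasure \<mu> C = 1}"

section \<open>The bounded Lipschitz metric\<close>

text \<open>Both norms below are real-valued infima and suprema, hence meaningful only for functions that
  are Lipschitz, respectively bounded, on a nonempty \<open>X\<close>; Lipschitz functions on a
  compact \<open>X\<close> are bounded.\<close>

definition sup_norm :: "'a set \<Rightarrow> ('a \<Rightarrow> real) \<Rightarrow> real" where
  "sup_norm X f = (SUP x\<in>X. \<bar>f x\<bar>)"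

definition lipschitz_norm :: "'a::metric_space set \<Rightarrow> ('a \<Rightarrow> real) \<Rightarrow> real" where
  "lipschitz_norm X f = Inf {L. L-lipschitz_on X f}"

definition BL_ball :: "'a::metric_space set \<Rightarrow> ('a \<Rightarrow> real) set" where
  "BL_ball X = {f. (\<exists>L. L-lipschitz_on X f) \<and> sup_norm X f + lipschitz_norm X f \<le> 1}"

definition dense_sequence_BL :: "'a::metric_space set \<Rightarrow> (nat \<Rightarrow> 'a \<Rightarrow> real) \<Rightarrow> bool" where
  "dense_sequence_BL X f \<longleftrightarrow> (\<forall>n. f n \<in> BL_ball X) \<and>
     (\<forall>g\<in>BL_ball X. \<forall>\<eta>>0. \<exists>n. sup_norm X (\<lambda>x. f n x - g x) < \<eta>)"

text \<open>Sequences are indexed from \<open>0\<close>, so the weight \<open>2\<^sup>-\<^sup>n\<close> with \<open>n \<ge> 1\<close> becomes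
  \<open>(1/2) ^ Suc n\<close>.\<close>

definition d_BL :: "(nat \<Rightarrow> 'a \<Rightarrow> real) \<Rightarrow> 'a measure \<Rightarrow> 'a measure \<Rightarrow> real" where
  "d_BL f \<mu> \<nu> = (\<Sum>n. (1/2) ^ Suc n * \<bar>integral\<^sup>L \<mu> (f n) - integral\<^sup>L \<nu> (f n)\<bar>)"

section \<open>Odometers\<close>

definition regularly_recurrent :: "'a::metric_space set \<Rightarrow> ('a \<Rightarrow> 'a) \<Rightarrow> 'a \<Rightarrow> bool" where
  "regularly_recurrent X T x \<longleftrightarrow> x \<in> X \<and>
     (\<forall>U. openin (top_of_set X) U \<and> x \<in> U \<longrightarrow> (\<exists>k\<ge>1. \<forall>n. (T ^^ (k * n)) x \<in> U))"

definition equicontinuous_system :: "'a::metric_space set \<Rightarrow> ('a \<Rightarrow> 'a) \<Rightarrow> bool" where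
  "equicontinuous_system X T \<longleftrightarrow>
     (\<forall>\<epsilon>>0. \<exists>\<delta>>0. \<forall>x\<in>X. \<forall>y\<in>X. dist x y < \<delta> \<longrightarrow>
        (\<forall>n. dist ((T ^^ n) x) ((T ^^ n) y) < \<epsilon>))"

definition odometer :: "'a::metric_space set \<Rightarrow> ('a \<Rightarrow> 'a) \<Rightarrow> bool" where
  "odometer Z T \<longleftrightarrow> dynamical_system Z T \<and> equicontinuous_system Z T \<and>
     (\<exists>z. regularly_recurrent Z T z \<and> Z \<subseteq> closure (range (\<lambda>n. (T ^^ n) z)))"

definition supported_on_odometer :: "'a::metric_space set \<Rightarrow> ('a \<Rightarrow> 'a) \<Rightarrow> 'a measure \<Rightarrow> bool" where
  "supported_on_odometer X T \<nu> \<longleftrightarrow>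
     (\<exists>Z. closed Z \<and> Z \<subseteq> X \<and> T ` Z \<subseteq> Z \<and> emeasure \<nu> Z = 1 \<and> odometer Z T)"

end

theory Submission
  imports Defs
begin

text \<open>Averaging the empirical measures of orbit segments of length \<open>N\<close> over \<open>\<mu>\<close> gives back \<open>\<mu>\<close>, by
  invariance alone; hence finitely many such segments, starting in the support, approximate \<open>\<mu>\<close>.
  For \<open>N\<close> large the connecting chains inside the chain-recurrent class are negligible, so \<open>\<mu>\<close> is
  close to the empirical measure of a periodic pseudo-orbit.

  A point tracing a pseudo-orbit of period \<open>p\<close> nearly returns under some multiple of \<open>p\<close>, so a
  piece of its orbit closes up to a finer periodic pseudo-orbit whose period is a multiple of \<open>p\<close>.
  Iterating with summable errors, the periodic pseudo-orbits converge uniformly in time to a true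
  orbit.  Being a uniform limit of periodic sequences, this orbit is equicontinuous and its
  point is regularly recurrent, so its closure is an odometer.

  The invariant measure of the odometer is the image of Lebesgue measure on \<open>[0,1)\<close> under the limit of
  \<open>u \<mapsto> T\<^sup>i z\<close>, where \<open>i\<close> is made of the mixed-radix digits of \<open>u\<close>.  Birkhoff averages converge
  uniformly on the odometer, hence it is uniquely ergodic.\<close>

section \<open>Measures on compact systems\<close>

text \<open>Closed sets form an intersection-stable generator of the Borel sets, and the indicator
  of a nonempty closed set \<open>C\<close> is the pointwise limit of the Lipschitz functions
  \<open>max 0 (1 - real n * infdist x C)\<close>. Dominated convergence then passes from integrals
  to masses.\<close>

lemma prob_measure_eqI_lipschitz:
  fixes X :: "'a::metric_space set"
  assumes X: "closed X"
    and M: "prob_space M" "sets M = sets (restrict_space borel X)"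
    and N: "prob_space N" "sets N = sets (restrict_space borel X)"
    and eq: "\<And>g L. L-lipschitz_on X g \<Longrightarrow> integral\<^sup>L M g = (integral\<^sup>L N g :: real)"
  shows "M = N"
proof -
  interpret M: prob_space M by (rule M)
  interpret N: prob_space N by (rule N)
  have sp: "space M = X" "space N = X"
    using sets_eq_imp_space_eq[OF M(2)] sets_eq_imp_space_eq[OF N(2)]
    by (simp_all add: space_restrict_space)
  have lim: "(\<lambda>n. integral\<^sup>L K (\<lambda>x. max 0 (1 - real n * infdist x C))) \<longlonglongrightarrow> measure K (C \<inter> X)"
    if K: "prob_space K" "sets K = sets (restrict_space borel X)" and C: "closed C" "C \<noteq> {}" for K and C :: "'a set"
  proof -
    interpret K: prob_space K by (rule K)
    have spK: "space K = X"
      using sets_eq_imp_space_eq[OF K(2)] by (simp add: space_restrict_space)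
    have meas: "(\<lambda>x. max 0 (1 - real n * infdist x C)) \<in> borel_measurable K" for n
    proof -
      have "(\<lambda>x. max 0 (1 - real n * infdist x C)) \<in> borel_measurable borel"
        by (intro borel_measurable_continuous_onI continuous_intros)
      from measurable_restrict_space1[OF this, of X]
      show ?thesis by (simp add: measurable_cong_sets[OF K(2) refl])
    qed
    have CK: "C \<inter> X \<in> sets K"
      unfolding K(2) sets_restrict_space by (rule image_eqI[of _ _ C]) (use C in auto)
    have "(\<lambda>n. integral\<^sup>L K (\<lambda>x. max 0 (1 - real n * infdist x C))) \<longlonglongrightarrow> integral\<^sup>L K (indicat_real (C \<inter> X))"
    proof (rule integral_dominated_convergence[where w = "\<lambda>_. 1"])
      show "AE x in K. (\<lambda>n. max 0 (1 - real n * infdist x C)) \<longlonglongrightarrow> indicat_real (C \<inter> X) x"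
      proof (rule AE_I2)
        fix x assume "x \<in> space K"
        then have x: "x \<in> X" using spK by simp
        show "(\<lambda>n. max 0 (1 - real n * infdist x C)) \<longlonglongrightarrow> indicat_real (C \<inter> X) x"
        proof (cases "x \<in> C")
          case True
          then show ?thesis using x by simp
        next
          case False
          then have pos: "infdist x C > 0"
            using C in_closed_iff_infdist_zero infdist_nonneg[of x C] by (metis less_eq_real_def)
          obtain n0 :: nat where n0: "1 < real n0 * infdist x C"
            using reals_Archimedean3[OF pos] by blast
          have "\<forall>\<^sub>F n in sequentially. max 0 (1 - real n * infdist x C) = 0"
            unfolding eventually_sequentially
          proof (intro exI[of _ n0] allI impI)
            fix n assume "n0 \<le> n"
            then have "real n0 * infdist x C \<le> real n * infdist x C"
              using pos by (simp add: mult_right_mono)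
            then show "max 0 (1 - real n * infdist x C) = 0" using n0 by simp
          qed
          then show ?thesis using False by (simp add: tendsto_eventually)
        qed
      qed
      show "AE x in K. norm (max 0 (1 - real n * infdist x C)) \<le> 1" for n
        by (auto simp: infdist_nonneg)
    qed (use meas CK in auto)
    also have "integral\<^sup>L K (indicat_real (C \<inter> X)) = measure K (C \<inter> X)"
      using CK by simp
    finally show ?thesis .
  qed
  have idM: "(\<lambda>x. x) \<in> measurable M borel" "(\<lambda>x. x) \<in> measurable N borel"
    using measurable_restrict_space1[of "\<lambda>x. x" borel borel X]
    by (simp_all add: measurable_cong_sets[OF M(2) refl] measurable_cong_sets[OF N(2) refl])
  have closed_eq: "measure M (C \<inter> X) = measure N (C \<inter> X)" if C: "closed C" for C
  proof (cases "C = {}")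
    case False
    have "integral\<^sup>L M (\<lambda>x. max 0 (1 - real n * infdist x C)) = integral\<^sup>L N (\<lambda>x. max 0 (1 - real n * infdist x C))" for n
    proof (rule eq[of "real n"], rule lipschitz_onI)
      fix x y
      have "\<bar>infdist x C - infdist y C\<bar> \<le> dist x y" by (rule infdist_triangle_abs)
      then have "\<bar>real n * infdist x C - real n * infdist y C\<bar> \<le> real n * dist x y"
        by (metis abs_mult abs_of_nat mult_left_mono of_nat_0_le_iff right_diff_distrib)
      then show "dist (max 0 (1 - real n * infdist x C)) (max 0 (1 - real n * infdist y C)) \<le> real n * dist x y"
        unfolding dist_real_def by linarith
    qed simp
    then show ?thesis using lim[OF M C False] lim[OF N C False] LIMSEQ_unique by simp
  qed simp
  have fin: "emeasure (distr M borel (\<lambda>x. x)) UNIV \<noteq> \<infinity>"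
    by (simp add: emeasure_distr idM sp M.emeasure_eq_measure)
  \<comment> \<open>Both measures are pushed to the whole type, where the closed sets generate.
    Since \<open>X\<close> is closed, measurable subsets of \<open>X\<close> are Borel in the whole
    type, which brings the equality back.\<close>
  have "distr M borel (\<lambda>x. x) = distr N borel (\<lambda>x. x)"
  proof (rule measure_eqI_generator_eq[where E = "Collect closed" and A = "\<lambda>_. UNIV" and \<Omega> = UNIV])
    show "Int_stable (Collect closed)" by (auto simp: Int_stable_def)
    fix C :: "'a set" assume "C \<in> Collect closed"
    then show "emeasure (distr M borel (\<lambda>x. x)) C = emeasure (distr N borel (\<lambda>x. x)) C"
      using closed_eq[of C]
      by (simp add: emeasure_distr idM sp M.emeasure_eq_measure N.emeasure_eq_measure)
  qed (use fin in \<open>auto simp: borel_eq_closed\<close>)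
  then have *: "emeasure (distr M borel (\<lambda>x. x)) B = emeasure (distr N borel (\<lambda>x. x)) B" for B
    by simp
  show ?thesis
  proof (rule measure_eqI)
    show "sets M = sets N" using M N by simp
    fix B assume B: "B \<in> sets M"
    then have "B \<in> sets borel" "B \<subseteq> X"
      using X unfolding M(2) sets_restrict_space by auto
    with *[of B] show "emeasure M B = emeasure N B"
      by (simp add: emeasure_distr idM sp Int_absorb2)
  qed
qed

section \<open>Continuous functions and invariant measures on a compact system\<close>

locale compact_system =
  fixes X :: "'a::metric_space set" and T :: "'a \<Rightarrow> 'a"
  assumes system: "dynamical_system X T"
begin

lemma compact: "compact X" and cont: "continuous_on X T" and maps: "T ` X \<subseteq> X"
  using system by (auto simp: dynamical_system_def)

lemma closed: "closed X"
  using compact by (rule compact_imp_closed)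

lemma funpow_in: "x \<in> X \<Longrightarrow> (T ^^ n) x \<in> X"
  by (induction n) (use maps in auto)

lemma continuous_on_funpow: "continuous_on X (T ^^ n)"
proof (induction n)
  case (Suc n)
  have "continuous_on X (T \<circ> T ^^ n)"
    by (rule continuous_on_compose[OF Suc continuous_on_subset[OF cont]]) (use funpow_in in auto)
  then show ?case by simp
qed (simp add: continuous_on_id)

text \<open>A minimum of finitely many moduli serves the first \<open>k\<close> iterates at once. It
  gives equicontinuity of the orbit closure and later controls time averages.\<close>

lemma funpow_uniformly_continuous:
  assumes "\<epsilon> > 0"
  shows "\<exists>\<delta>>0. \<forall>r<k. \<forall>x\<in>X. \<forall>y\<in>X. dist x y < \<delta> \<longrightarrow> dist ((T ^^ r) x) ((T ^^ r) y) < \<epsilon>"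
proof (induction k)
  case (Suc k)
  then obtain \<delta> where \<delta>: "\<delta> > 0"
    "\<And>r x y. r < k \<Longrightarrow> x \<in> X \<Longrightarrow> y \<in> X \<Longrightarrow> dist x y < \<delta> \<Longrightarrow> dist ((T ^^ r) x) ((T ^^ r) y) < \<epsilon>"
    by blast
  have "uniformly_continuous_on X (T ^^ k)"
    by (rule compact_uniformly_continuous[OF continuous_on_funpow compact])
  then obtain \<delta>' where \<delta>': "\<delta>' > 0"
    "\<And>x y. x \<in> X \<Longrightarrow> y \<in> X \<Longrightarrow> dist x y < \<delta>' \<Longrightarrow> dist ((T ^^ k) x) ((T ^^ k) y) < \<epsilon>"
    using assms unfolding uniformly_continuous_on_def by metis
  show ?case
    using \<delta> \<delta>' by (intro exI[of _ "min \<delta> \<delta>'"]) (auto simp: less_Suc_eq)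
qed (auto intro: exI[of _ 1])

lemma continuous_on_comp_funpow:
  "continuous_on X g \<Longrightarrow> continuous_on X (\<lambda>x. g ((T ^^ n) x))"
  by (rule continuous_on_compose2[OF _ continuous_on_funpow]) (use funpow_in in auto)

lemma measurable_T:
  assumes M: "sets M = sets (restrict_space borel X)"
  shows "T \<in> measurable M M"
proof -
  have "T \<in> measurable (restrict_space borel X) (restrict_space borel X)"
    by (rule measurable_restrict_space2[OF _ borel_measurable_continuous_on_restrict[OF cont]])
      (use maps in \<open>auto simp: space_restrict_space\<close>)
  then show ?thesis
    unfolding measurable_cong_sets[OF M M] .
qed

lemma borel_measurable_cont:
  assumes M: "sets M = sets (restrict_space borel X)" and g: "continuous_on X g"
  shows "g \<in> borel_measurable M"
  using borel_measurable_continuous_on_restrict[OF g]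
  unfolding measurable_cong_sets[OF M refl] .

lemma integrable_cont:
  fixes g :: "'a \<Rightarrow> real"
  assumes "prob_space M" and M: "sets M = sets (restrict_space borel X)" and g: "continuous_on X g"
  shows "integrable M g"
proof -
  interpret prob_space M by fact
  have sp: "space M = X"
    using sets_eq_imp_space_eq[OF M] by (simp add: space_restrict_space)
  have "bounded (g ` X)"
    by (rule compact_imp_bounded[OF compact_continuous_image[OF g compact]])
  then obtain b where "\<And>x. x \<in> X \<Longrightarrow> norm (g x) \<le> b"
    by (auto simp: bounded_iff)
  then show ?thesis
    by (intro integrable_const_bound[where B = b] AE_I2 borel_measurable_cont[OF M g]) (auto simp: sp)
qed

lemma invariant_measureD:
  assumes "\<kappa> \<in> invariant_measures X T"
  shows "prob_space \<kappa>" "sets \<kappa> = sets (restrict_space borel X)" "space \<kappa> = X"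
    "distr \<kappa> \<kappa> T = \<kappa>"
proof -
  show p: "prob_space \<kappa>" and s: "sets \<kappa> = sets (restrict_space borel X)"
    using assms unfolding invariant_measures_def by blast+
  show sp: "space \<kappa> = X"
    using sets_eq_imp_space_eq[OF s] by (simp add: space_restrict_space)
  show "distr \<kappa> \<kappa> T = \<kappa>"
    by (rule measure_eqI)
      (use assms in \<open>auto simp: emeasure_distr measurable_T[OF s] sp invariant_measures_def\<close>)
qed

lemma invariant_integral_funpow:
  fixes g :: "'a \<Rightarrow> real"
  assumes inv: "\<kappa> \<in> invariant_measures X T" and g: "continuous_on X g"
  shows "(\<integral>x. g ((T ^^ n) x) \<partial>\<kappa>) = integral\<^sup>L \<kappa> g"
proof (induction n)
  case (Suc n)
  note inv' = invariant_measureD[OF inv]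
  have "(\<integral>x. g ((T ^^ n) x) \<partial>\<kappa>) = (\<integral>x. g ((T ^^ n) x) \<partial>(distr \<kappa> \<kappa> T))"
    using inv' by simp
  also have "\<dots> = (\<integral>x. g ((T ^^ n) (T x)) \<partial>\<kappa>)"
    by (intro integral_distr measurable_T[OF inv'(2)]
        borel_measurable_cont[OF inv'(2)] continuous_on_comp_funpow g)
  also have "\<dots> = (\<integral>x. g ((T ^^ Suc n) x) \<partial>\<kappa>)"
    by (simp add: funpow_swap1)
  finally show ?case using Suc by simp
qed simp

text \<open>This turns estimates on finite orbit averages into estimates on \<open>\<kappa>\<close>;
  it gives unique ergodicity on an odometer and lets orbit segments replace
  \<open>\<mu>\<close>.\<close>

lemma invariant_integral_average:
  fixes g :: "'a \<Rightarrow> real"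
  assumes inv: "\<kappa> \<in> invariant_measures X T" and g: "continuous_on X g" and N: "N > 0"
  shows "(\<integral>x. (\<Sum>i<N. g ((T ^^ i) x)) / real N \<partial>\<kappa>) = integral\<^sup>L \<kappa> g"
proof -
  have "(\<integral>x. (\<Sum>i<N. g ((T ^^ i) x)) \<partial>\<kappa>) = (\<Sum>i<N. (\<integral>x. g ((T ^^ i) x) \<partial>\<kappa>))"
    using invariant_measureD[OF inv]
    by (intro Bochner_Integration.integral_sum integrable_cont continuous_on_comp_funpow g)
  also have "\<dots> = real N * integral\<^sup>L \<kappa> g"
    by (simp add: invariant_integral_funpow[OF inv g])
  finally show ?thesis using N by simp
qed

end

section \<open>Uniformly recurrent points\<close>

text \<open>Each unit shift of the window drops \<open>h m\<close> and gains
  \<open>h (p + m)\<close>, which are equal.\<close>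

lemma sum_shift_periodic:
  fixes h :: "nat \<Rightarrow> 'b::ab_group_add"
  assumes "\<And>i. h (i + p) = h i"
  shows "(\<Sum>i<p. h (i + m)) = (\<Sum>i<p. h i)"
proof (induction m)
  case (Suc m)
  have "h m + (\<Sum>i<p. h (i + Suc m)) = (\<Sum>i<Suc p. h (i + m))"
    by (simp only: sum.lessThan_Suc_shift) simp
  also have "\<dots> = (\<Sum>i<p. h (i + m)) + h m"
    using assms[of m] by (simp add: add.commute)
  finally show ?case using Suc by simp
qed simp

text \<open>A form of regular recurrence that is uniform in time: up to \<open>e n\<close>, the
  position on the orbit depends only on the time modulo \<open>p n\<close>. Divisibility makes these
  residues compatible, as in an inverse limit of cyclic groups.\<close>

locale uniformly_recurrent = compact_system +
  fixes z :: "'a::metric_space" and p :: "nat \<Rightarrow> nat" and e :: "nat \<Rightarrow> real"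
  assumes z: "z \<in> X"
    and p_pos: "p n > 0"
    and p_dvd: "p n dvd p (Suc n)"
    and e_lim: "e \<longlonglongrightarrow> 0"
    and recurrent: "dist ((T ^^ (i + j * p n)) z) ((T ^^ i) z) \<le> e n"
begin

definition orbit_closure :: "'a set" where "orbit_closure = closure (range (\<lambda>n. (T ^^ n) z))"

lemma orbit_subset_orbit_closure: "(T ^^ n) z \<in> orbit_closure"
  unfolding orbit_closure_def by (rule closure_subset[THEN subsetD]) simp

lemma orbit_closure_subset: "orbit_closure \<subseteq> X"
  unfolding orbit_closure_def by (rule closure_minimal[OF _ closed]) (use funpow_in z in auto)

lemma closed_orbit_closure: "closed orbit_closure"
  by (simp add: orbit_closure_def)

text \<open>A non-strict inequality for a continuous function is a closed condition. Recurrence and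
  the estimates on averages are extended from the orbit of \<open>z\<close> in this way.\<close>

lemma orbit_closure_le:
  fixes g :: "'a \<Rightarrow> real"
  assumes "continuous_on X g" "\<And>m. g ((T ^^ m) z) \<le> c" "x \<in> orbit_closure"
  shows "g x \<le> c"
proof (rule continuous_le_on_closure[of "range (\<lambda>n. (T ^^ n) z)" g])
  show "continuous_on (closure (range (\<lambda>n. (T ^^ n) z))) g"
    using continuous_on_subset[OF assms(1) orbit_closure_subset] by (simp add: orbit_closure_def)
  show "x \<in> closure (range (\<lambda>n. (T ^^ n) z))"
    using assms(3) by (simp add: orbit_closure_def)
qed (use assms(2) in auto)

lemma orbit_closure_invariant: "T ` orbit_closure \<subseteq> orbit_closure"
proof -
  have "T ` closure (range (\<lambda>n. (T ^^ n) z)) \<subseteq> orbit_closure"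
  proof (rule image_closure_subset[OF _ closed_orbit_closure])
    show "continuous_on (closure (range (\<lambda>n. (T ^^ n) z))) T"
      using continuous_on_subset[OF cont orbit_closure_subset] by (simp add: orbit_closure_def)
    show "T ` range (\<lambda>n. (T ^^ n) z) \<subseteq> orbit_closure"
      using orbit_subset_orbit_closure[of "Suc _"] by auto
  qed
  then show ?thesis by (simp add: orbit_closure_def)
qed

text \<open>The bound for \<open>z\<close> at time \<open>i + m\<close> is the bound for the orbit
  point \<open>(T ^^ m) z\<close> at time \<open>i\<close>.\<close>

lemma recurrent_orbit_closure:
  assumes "x \<in> orbit_closure"
  shows "dist ((T ^^ (i + j * p n)) x) ((T ^^ i) x) \<le> e n"
proof (rule orbit_closure_le[OF _ _ assms])
  show "continuous_on X (\<lambda>x. dist ((T ^^ (i + j * p n)) x) ((T ^^ i) x))"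
    by (intro continuous_intros continuous_on_funpow)
  show "dist ((T ^^ (i + j * p n)) ((T ^^ m) z)) ((T ^^ i) ((T ^^ m) z)) \<le> e n" for m
    using recurrent[of "i + m" j n]
    by (simp add: funpow_add[symmetric, THEN fun_cong, simplified] add_ac)
qed

text \<open>For equicontinuity, times are reduced modulo \<open>p n\<close> at the cost of
  \<open>e n\<close> for either point, which leaves finitely many iterates and hence uniform
  continuity. Regular recurrence comes from the returns at multiples of \<open>p n\<close>.\<close>

lemma odometer_orbit_closure: "odometer orbit_closure T"
  unfolding odometer_def
proof (intro conjI exI[of _ z])
  have cZ: "compact orbit_closure"
    by (rule closed_Int_compact[OF closed_orbit_closure compact, of, simplified Int_absorb2[OF orbit_closure_subset]])
  then show "dynamical_system orbit_closure T"
    using continuous_on_subset[OF cont orbit_closure_subset] orbit_closure_invariant by (simp add: dynamical_system_def)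
  have e_small: "\<exists>n. e n < \<epsilon>" if "\<epsilon> > 0" for \<epsilon>
    using order_tendstoD(2)[OF e_lim that] by (auto simp: eventually_sequentially)
  show "equicontinuous_system orbit_closure T"
    unfolding equicontinuous_system_def
  proof (intro allI impI)
    fix \<epsilon> :: real assume "\<epsilon> > 0"
    then have \<epsilon>3: "\<epsilon> / 3 > 0" by simp
    obtain n where n: "e n < \<epsilon> / 3" using e_small[OF \<epsilon>3] by blast
    obtain \<delta> where \<delta>: "\<delta> > 0"
      "\<And>r x y. r < p n \<Longrightarrow> x \<in> X \<Longrightarrow> y \<in> X \<Longrightarrow> dist x y < \<delta> \<Longrightarrow> dist ((T ^^ r) x) ((T ^^ r) y) < \<epsilon> / 3"
      using funpow_uniformly_continuous[OF \<epsilon>3, of "p n"] by blast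
    have "dist ((T ^^ m) x) ((T ^^ m) y) < \<epsilon>" if "x \<in> orbit_closure" "y \<in> orbit_closure" "dist x y < \<delta>" for x y m
    proof -
      let ?r = "m mod p n"
      have m: "?r + (m div p n) * p n = m" by simp
      have "dist ((T ^^ m) x) ((T ^^ ?r) x) \<le> e n" "dist ((T ^^ m) y) ((T ^^ ?r) y) \<le> e n"
        using recurrent_orbit_closure[OF that(1), of ?r "m div p n" n] recurrent_orbit_closure[OF that(2), of ?r "m div p n" n]
        unfolding m .
      moreover have "dist ((T ^^ ?r) x) ((T ^^ ?r) y) < \<epsilon> / 3"
        using p_pos that orbit_closure_subset by (intro \<delta>) auto
      ultimately show ?thesis
        using n dist_triangle[of "(T ^^ m) x" "(T ^^ m) y" "(T ^^ ?r) x"]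
          dist_triangle[of "(T ^^ ?r) x" "(T ^^ m) y" "(T ^^ ?r) y"]
        by (simp add: dist_commute)
    qed
    with \<delta>(1) show "\<exists>\<delta>>0. \<forall>x\<in>orbit_closure. \<forall>y\<in>orbit_closure. dist x y < \<delta> \<longrightarrow> (\<forall>n. dist ((T ^^ n) x) ((T ^^ n) y) < \<epsilon>)"
      by blast
  qed
  show "regularly_recurrent orbit_closure T z"
    unfolding regularly_recurrent_def
  proof (intro conjI allI impI)
    show "z \<in> orbit_closure" using orbit_subset_orbit_closure[of 0] by simp
    fix U assume U: "openin (top_of_set orbit_closure) U \<and> z \<in> U"
    then obtain \<epsilon> where \<epsilon>: "\<epsilon> > 0" "ball z \<epsilon> \<inter> orbit_closure \<subseteq> U"
      by (auto simp: openin_contains_ball)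
    obtain n where n: "e n < \<epsilon>" using e_small[OF \<epsilon>(1)] by blast
    have "(T ^^ (p n * j)) z \<in> U" for j
      using recurrent[of 0 j n] n orbit_subset_orbit_closure[of "p n * j"] \<epsilon>(2)
      by (auto simp: dist_commute mult.commute)
    then show "\<exists>k\<ge>1. \<forall>j. (T ^^ (k * j)) z \<in> U"
      using p_pos[of n] by (intro exI[of _ "p n"]) auto
  qed
qed (simp add: orbit_closure_def)

section \<open>Birkhoff averages over the periods\<close>

abbreviation average :: "nat \<Rightarrow> ('a \<Rightarrow> real) \<Rightarrow> 'a \<Rightarrow> real" where
  "average n g x \<equiv> (\<Sum>i<p n. g ((T ^^ i) x)) / real (p n)"

text \<open>Starting at another orbit point shifts the window of summation. Up to
  \<open>L * e n\<close> the values of \<open>g\<close> along the orbit are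
  \<open>p n\<close>-periodic, and a periodic sequence has the same sum over every window of that
  length.\<close>

lemma average_close:
  assumes g: "L-lipschitz_on X g" and x: "x \<in> orbit_closure"
  shows "\<bar>average n g x - average n g z\<bar> \<le> L * e n"
proof (rule orbit_closure_le[OF _ _ x])
  show "continuous_on X (\<lambda>x. \<bar>average n g x - average n g z\<bar>)"
    using p_pos[of n]
    by (intro continuous_intros continuous_on_comp_funpow lipschitz_on_continuous_on[OF g]) auto
  fix m
  define h where "h i = g ((T ^^ (i mod p n)) z)" for i
  have close: "\<bar>g ((T ^^ i) z) - h i\<bar> \<le> L * e n" for i
  proof -
    have "dist ((T ^^ i) z) ((T ^^ (i mod p n)) z) \<le> e n"
      using recurrent[of "i mod p n" "i div p n" n] by simp
    then have "L * dist ((T ^^ i) z) ((T ^^ (i mod p n)) z) \<le> L * e n"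
      using lipschitz_on_nonneg[OF g] by (rule mult_left_mono)
    with lipschitz_onD[OF g funpow_in[OF z] funpow_in[OF z], of i "i mod p n"] show ?thesis
      by (simp add: h_def dist_real_def)
  qed
  \<comment> \<open>On the initial window the periodic sequence \<open>h\<close> agrees with the
    orbit exactly, so the error is incurred only for the shifted window.\<close>
  have "(\<Sum>i<p n. g ((T ^^ i) z)) = (\<Sum>i<p n. h i)"
    by (rule sum.cong) (auto simp: h_def)
  also have "\<dots> = (\<Sum>i<p n. h (i + m))"
    by (rule sum_shift_periodic[symmetric]) (simp add: h_def)
  finally have "\<bar>(\<Sum>i<p n. g ((T ^^ i) ((T ^^ m) z))) - (\<Sum>i<p n. g ((T ^^ i) z))\<bar>
      = \<bar>\<Sum>i<p n. g ((T ^^ (i + m)) z) - h (i + m)\<bar>"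
    by (simp add: sum_subtractf funpow_add)
  also have "\<dots> \<le> (\<Sum>i<p n. \<bar>g ((T ^^ (i + m)) z) - h (i + m)\<bar>)"
    by (rule sum_abs)
  also have "\<dots> \<le> (\<Sum>i<p n. L * e n)"
    by (intro sum_mono close)
  finally have "\<bar>(\<Sum>i<p n. g ((T ^^ i) ((T ^^ m) z))) - (\<Sum>i<p n. g ((T ^^ i) z))\<bar> \<le> real (p n) * (L * e n)"
    by simp
  then show "\<bar>average n g ((T ^^ m) z) - average n g z\<bar> \<le> L * e n"
    using p_pos[of n]
    by (simp add: diff_divide_distrib[symmetric] abs_divide divide_le_eq mult.commute)
qed

text \<open>By invariance \<open>g\<close> may be replaced by its average, which on the orbit
  closure is constant up to \<open>L * e n\<close>. The approximating value does not depend on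
  \<open>\<kappa>\<close>, whence unique ergodicity.\<close>

lemma invariant_integral_close:
  assumes inv: "\<kappa> \<in> invariant_measures X T" and full: "emeasure \<kappa> orbit_closure = 1"
    and g: "L-lipschitz_on X g"
  shows "\<bar>integral\<^sup>L \<kappa> g - average n g z\<bar> \<le> L * e n"
proof -
  note inv' = invariant_measureD[OF inv]
  interpret prob_space \<kappa> by (rule inv')
  have gc: "continuous_on X g" by (rule lipschitz_on_continuous_on[OF g])
  have "orbit_closure \<in> sets \<kappa>"
    using closed_orbit_closure orbit_closure_subset closed unfolding inv'(2) sets_restrict_space by auto
  then have "AE x in \<kappa>. x \<in> orbit_closure"
    using full AE_in_set_eq_1 emeasure_eq_measure by simp
  then have AE: "AE x in \<kappa>. \<bar>average n g x - average n g z\<bar> \<le> L * e n"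
    by (rule AE_mp) (auto intro: average_close[OF g])
  have int: "integrable \<kappa> (average n g)"
    using p_pos[of n]
    by (intro integrable_cont continuous_intros continuous_on_comp_funpow gc inv') auto
  have "AE x in \<kappa>. average n g x \<le> average n g z + L * e n"
    "AE x in \<kappa>. average n g z - L * e n \<le> average n g x"
    using AE by (auto elim!: eventually_mono)
  from integral_le_const[OF int this(1)] integral_ge_const[OF int this(2)] have "\<bar>integral\<^sup>L \<kappa> (average n g) - average n g z\<bar> \<le> L * e n"
    by linarith
  then show ?thesis
    using invariant_integral_average[OF inv gc p_pos[of n]] by simp
qed

end

section \<open>The invariant measure of an odometer\<close>

text \<open>Reading the digits of \<open>m\<close> in reverse order: the leading digit of \<open>u \<in> [0,1)\<close> becomes the least
  significant one, so that refining \<open>\<lfloor>u p\<^sub>n\<rfloor>\<close> to \<open>\<lfloor>u p\<^sub>n\<^sub>+\<^sub>1\<rfloor>\<close> changes the value only by multiples of \<open>p\<^sub>n\<close>.\<close>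

primrec mixed_radix :: "(nat \<Rightarrow> nat) \<Rightarrow> nat \<Rightarrow> nat \<Rightarrow> nat" where
  "mixed_radix p 0 m = m"
| "mixed_radix p (Suc n) m = mixed_radix p n (m div (p (Suc n) div p n)) + p n * (m mod (p (Suc n) div p n))"

text \<open>The residue modulo \<open>p n\<close> recovers the value at level \<open>n\<close>, and
  the quotient by \<open>p n\<close> recovers the new digit \<open>m mod k\<close>. This gives
  injectivity by induction, and an injective self-map of a finite set is onto.\<close>

lemma mixed_radix_bij:
  assumes pos: "\<And>n. p n > 0" and dvd: "\<And>n. p n dvd p (Suc n)"
  shows "bij_betw (mixed_radix p n) {..<p n} {..<p n}"
proof (induction n)
  case 0
  show ?case by (simp add: bij_betw_def inj_on_def)
next
  case (Suc n)
  define k where "k = p (Suc n) div p n"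
  have pk: "p (Suc n) = p n * k" using dvd by (simp add: k_def)
  have k: "k > 0" using pos[of "Suc n"] pk by simp
  have lt: "mixed_radix p n (m div k) < p n" "m div k < p n" if "m < p (Suc n)" for m
  proof -
    show "m div k < p n" using that k by (simp add: pk less_mult_imp_div_less)
    then show "mixed_radix p n (m div k) < p n"
      using bij_betwE[OF Suc] by auto
  qed
  have mr: "mixed_radix p (Suc n) m = mixed_radix p n (m div k) + p n * (m mod k)" for m
    by (simp add: k_def)
  have inj: "inj_on (mixed_radix p (Suc n)) {..<p (Suc n)}"
  proof (rule inj_onI)
    fix a b assume ab: "a \<in> {..<p (Suc n)}" "b \<in> {..<p (Suc n)}"
      and eq: "mixed_radix p (Suc n) a = mixed_radix p (Suc n) b"
    have "mixed_radix p (Suc n) m mod p n = mixed_radix p n (m div k)"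
      "mixed_radix p (Suc n) m div p n = m mod k" if "m < p (Suc n)" for m
      using lt[OF that] unfolding mr by auto
    with ab eq have "mixed_radix p n (a div k) = mixed_radix p n (b div k)" "a mod k = b mod k"
      by (metis lessThan_iff)+
    moreover from this(1) have "a div k = b div k"
      using inj_onD[OF bij_betw_imp_inj_on[OF Suc]] lt ab by simp
    ultimately show "a = b" by (metis div_mult_mod_eq)
  qed
  have "mixed_radix p (Suc n) m < p (Suc n)" if "m < p (Suc n)" for m
  proof -
    have "m mod k + 1 \<le> k" using k by (simp add: Suc_leI)
    then have "p n * (m mod k + 1) \<le> p n * k" by (rule mult_le_mono2)
    with lt[OF that] show ?thesis unfolding mr pk by simp
  qed
  then have "mixed_radix p (Suc n) ` {..<p (Suc n)} = {..<p (Suc n)}"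
    using endo_inj_surj[OF _ _ inj] by auto
  with inj show ?case unfolding bij_betw_def by blast
qed

lemma dvd_mono_seq:
  fixes p :: "nat \<Rightarrow> nat"
  assumes dvd: "\<And>n. p n dvd p (Suc n)" and "n \<le> m"
  shows "p n dvd p m"
  using \<open>n \<le> m\<close> by (induction m rule: dec_induct) (auto intro: dvd_trans dvd)

text \<open>Each refinement adds one digit with weight \<open>p m\<close>, a multiple of
  \<open>p n\<close>. Along the orbit of \<open>z\<close> such a change of time costs at most
  \<open>e n\<close>.\<close>

lemma mixed_radix_extends:
  fixes u :: real
  assumes pos: "\<And>n. p n > 0" and dvd: "\<And>n. p n dvd p (Suc n)" and "n \<le> m"
  shows "\<exists>j. mixed_radix p m (nat \<lfloor>u * p m\<rfloor>) = mixed_radix p n (nat \<lfloor>u * p n\<rfloor>) + j * p n"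
  using \<open>n \<le> m\<close>
proof (induction m rule: dec_induct)
  case base
  then show ?case by (intro exI[of _ 0]) simp
next
  case (step m)
  define k where "k = p (Suc m) div p m"
  have pk: "p (Suc m) = p m * k" using dvd by (simp add: k_def)
  have k: "k > 0" using pos[of "Suc m"] pk by simp
  have "u * p m = (u * p (Suc m)) / real_of_int (int k)"
    using k by (simp add: pk)
  then have "\<lfloor>u * p m\<rfloor> = \<lfloor>u * p (Suc m)\<rfloor> div int k"
    by (metis floor_divide_real_eq_div of_nat_0_le_iff)
  \<comment> \<open>For negative \<open>u\<close> both floors are negative and \<open>nat\<close>
    sends both to \<open>0\<close>.\<close>
  then have "nat \<lfloor>u * p m\<rfloor> = nat \<lfloor>u * p (Suc m)\<rfloor> div k"
    using k by (cases "\<lfloor>u * p (Suc m)\<rfloor> \<ge> 0")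
      (simp_all add: nat_div_distrib pos_imp_zdiv_neg_iff nat_le_iff order_less_imp_le del: floor_less_zero zero_le_floor)
  then have "mixed_radix p (Suc m) (nat \<lfloor>u * p (Suc m)\<rfloor>)
      = mixed_radix p m (nat \<lfloor>u * p m\<rfloor>) + p m * (nat \<lfloor>u * p (Suc m)\<rfloor> mod k)"
    by (simp add: k_def)
  moreover obtain c where c: "p m = p n * c"
    using dvd_mono_seq[of p, OF dvd step(1)] by auto
  moreover obtain j where "mixed_radix p m (nat \<lfloor>u * p m\<rfloor>) = mixed_radix p n (nat \<lfloor>u * p n\<rfloor>) + j * p n"
    using step.IH by blast
  ultimately have "mixed_radix p (Suc m) (nat \<lfloor>u * p (Suc m)\<rfloor>)
      = mixed_radix p n (nat \<lfloor>u * p n\<rfloor>) + (j + c * (nat \<lfloor>u * p (Suc m)\<rfloor> mod k)) * p n"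
    by (simp only: distrib_right) (simp only: ac_simps)
  then show ?case by blast
qed

abbreviation unit_lebesgue :: "real measure" where
  "unit_lebesgue \<equiv> restrict_space lborel {0..<1}"

lemma prob_space_unit_lebesgue: "prob_space unit_lebesgue"
  by (rule prob_space_restrict_space) auto

text \<open>The integrand is a step function with value \<open>h m\<close> on the interval from
  \<open>m / p\<close> to \<open>(m + 1) / p\<close>; these intervals partition \<open>[0,1)\<close>
  and have length \<open>1 / p\<close>.\<close>

lemma integral_floor_unit_lebesgue:
  fixes h :: "nat \<Rightarrow> real"
  assumes p: "p > 0"
  shows "(\<integral>u. h (nat \<lfloor>u * real p\<rfloor>) \<partial>unit_lebesgue) = (\<Sum>m<p. h m) / real p"
proof -
  have *: "indicat_real {0..<1} u *\<^sub>R h (nat \<lfloor>u * real p\<rfloor>)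
      = (\<Sum>m<p. h m * indicat_real {real m / real p..<(real m + 1) / real p} u)" for u
  proof (cases "u \<in> {0..<1}")
    case True
    define m0 where "m0 = nat \<lfloor>u * real p\<rfloor>"
    have "0 \<le> u * real p" "u * real p < real p" using True p by auto
    then have fl: "real m0 \<le> u * real p" "u * real p < real m0 + 1" and m0: "m0 < p"
      unfolding m0_def by linarith+
    have ind: "indicat_real {real m / real p..<(real m + 1) / real p} u = (if m = m0 then 1 else 0)" for m
    proof -
      have "u \<in> {real m / real p..<(real m + 1) / real p} \<longleftrightarrow> real m \<le> u * real p \<and> u * real p < real m + 1"
        using p by (auto simp: field_simps)
      also have "\<dots> \<longleftrightarrow> m = m0" using fl by linarith
      finally show ?thesis by (simp add: indicator_def)
    qed
    show ?thesis using True m0 unfolding ind by (simp add: m0_def[symmetric] if_distrib cong: if_cong)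
  next
    case False
    have "u \<notin> {real m / real p..<(real m + 1) / real p}" if "m < p" for m
    proof
      assume u: "u \<in> {real m / real p..<(real m + 1) / real p}"
      have "0 \<le> real m / real p" "(real m + 1) / real p \<le> 1" using that p by auto
      with u False show False by auto
    qed
    then show ?thesis using False by (auto intro!: sum.neutral[symmetric])
  qed
  have "(\<integral>u. h (nat \<lfloor>u * real p\<rfloor>) \<partial>unit_lebesgue)
      = (\<integral>u. indicat_real {0..<1} u *\<^sub>R h (nat \<lfloor>u * real p\<rfloor>) \<partial>lborel)"
    by (rule integral_restrict_space) simp
  also have "\<dots> = (\<integral>u. (\<Sum>m<p. h m * indicat_real {real m / real p..<(real m + 1) / real p} u) \<partial>lborel)"
    unfolding * ..
  also have "\<dots> = (\<Sum>m<p. \<integral>u. h m * indicat_real {real m / real p..<(real m + 1) / real p} u \<partial>lborel)"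
    by (intro Bochner_Integration.integral_sum integrable_mult_right integrable_real_indicator) (auto simp: ennreal_less_top divide_right_mono)
  also have "\<dots> = (\<Sum>m<p. h m * (1 / real p))"
    by (rule sum.cong) (auto simp: measure_def divide_right_mono diff_divide_distrib[symmetric])
  also have "\<dots> = (\<Sum>m<p. h m) / real p"
    by (simp add: sum_divide_distrib)
  finally show ?thesis .
qed

lemma Cauchy_tail_bound:
  fixes s :: "nat \<Rightarrow> 'a::metric_space" and e :: "nat \<Rightarrow> real"
  assumes tail: "\<And>n m. n \<le> m \<Longrightarrow> dist (s m) (s n) \<le> e n" and e: "e \<longlonglongrightarrow> 0"
  shows "Cauchy s"
proof (rule metric_CauchyI)
  fix \<epsilon> :: real assume "\<epsilon> > 0"
  then have "\<forall>\<^sub>F n in sequentially. e n < \<epsilon> / 2"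
    by (intro order_tendstoD(2)[OF e]) simp
  then obtain N where N: "e N < \<epsilon> / 2"
    by (auto simp: eventually_sequentially)
  have "dist (s m) (s n) < \<epsilon>" if "N \<le> m" "N \<le> n" for m n
    using dist_triangle2[of "s m" "s n" "s N"] tail[OF that(1)] tail[OF that(2)] N by linarith
  then show "\<exists>M. \<forall>m\<ge>M. \<forall>n\<ge>M. dist (s m) (s n) < \<epsilon>" by blast
qed

section \<open>Unique ergodicity and the parametrization of the odometer by the unit
  interval\<close>

context uniformly_recurrent
begin

text \<open>Applied with \<open>c n\<close> the average over \<open>p n\<close> steps from
  \<open>z\<close>: integrals with the same approximating averages coincide.\<close>

lemma eq_if_close:
  fixes a b :: real
  assumes "\<And>n. \<bar>a - c n\<bar> \<le> A * e n" "\<And>n. \<bar>b - c n\<bar> \<le> B * e n"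
  shows "a = b"
proof -
  have "\<bar>a - b\<bar> \<le> (A + B) * e n" for n
    using assms[of n] by (simp add: distrib_right)
  moreover have "(\<lambda>n. (A + B) * e n) \<longlonglongrightarrow> 0"
    using tendsto_mult_right_zero[OF e_lim] by simp
  ultimately have "\<bar>a - b\<bar> \<le> 0"
    by (intro LIMSEQ_le_const) auto
  then show ?thesis by simp
qed

lemma invariant_measure_unique:
  assumes "\<kappa> \<in> invariant_measures X T" "emeasure \<kappa> orbit_closure = 1"
    and "\<nu> \<in> invariant_measures X T" "emeasure \<nu> orbit_closure = 1"
  shows "\<kappa> = \<nu>"
  using invariant_integral_close[OF assms(1,2)] invariant_integral_close[OF assms(3,4)]
  by (intro prob_measure_eqI_lipschitz[OF closed] invariant_measureD[OF assms(1)]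
      invariant_measureD[OF assms(3)]) (rule eq_if_close)

text \<open>On \<open>[0,1)\<close> this is a step function on intervals of length
  \<open>1 / p n\<close> that uses each time below \<open>p n\<close> exactly once.\<close>

definition approx :: "nat \<Rightarrow> real \<Rightarrow> 'a" where
  "approx n u = (T ^^ mixed_radix p n (nat \<lfloor>u * real (p n)\<rfloor>)) z"

definition param :: "real \<Rightarrow> 'a" where
  "param u = lim (\<lambda>n. approx n u)"

lemma approx_in: "approx n u \<in> orbit_closure"
  unfolding approx_def by (rule orbit_subset_orbit_closure)

text \<open>The two times differ by a multiple of \<open>p n\<close>. The extra iterate
  \<open>k\<close> is free because recurrence is uniform in time; it is needed to compare the
  measure with its image under \<open>T\<close>.\<close>

lemma approx_close:
  assumes "n \<le> m"
  shows "dist ((T ^^ k) (approx m u)) ((T ^^ k) (approx n u)) \<le> e n"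
proof -
  obtain j where j: "mixed_radix p m (nat \<lfloor>u * real (p m)\<rfloor>) = mixed_radix p n (nat \<lfloor>u * real (p n)\<rfloor>) + j * p n"
    using mixed_radix_extends[of p n m u, OF p_pos p_dvd assms] by blast
  show ?thesis
    using recurrent[of "k + mixed_radix p n (nat \<lfloor>u * real (p n)\<rfloor>)" j n]
    by (simp add: approx_def j funpow_add add.assoc)
qed

lemma approx_tendsto: "(\<lambda>n. approx n u) \<longlonglongrightarrow> param u"
proof -
  have "Cauchy (\<lambda>n. approx n u)"
    by (rule Cauchy_tail_bound[OF _ e_lim]) (use approx_close[of _ _ 0 u] in simp)
  moreover have "\<forall>n. approx n u \<in> X"
    using approx_in orbit_closure_subset by blast
  ultimately have "convergent (\<lambda>n. approx n u)"
    using completeE[OF compact_imp_complete[OF compact]] unfolding convergent_def by metis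
  then show ?thesis
    unfolding param_def by (simp add: convergent_LIMSEQ_iff)
qed

lemma param_in: "param u \<in> orbit_closure"
  by (rule closed_sequentially[OF closed_orbit_closure _ approx_tendsto]) (rule approx_in)

lemma param_close: "dist ((T ^^ k) (param u)) ((T ^^ k) (approx n u)) \<le> e n"
proof (rule LIMSEQ_le_const2)
  have "(\<lambda>m. (T ^^ k) (approx m u)) \<longlonglongrightarrow> (T ^^ k) (param u)"
    by (rule continuous_on_tendsto_compose[OF continuous_on_funpow approx_tendsto])
      (use approx_in param_in orbit_closure_subset in \<open>auto intro!: always_eventually\<close>)
  then show "(\<lambda>m. dist ((T ^^ k) (approx m u)) ((T ^^ k) (approx n u)))
      \<longlonglongrightarrow> dist ((T ^^ k) (param u)) ((T ^^ k) (approx n u))"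
    by (intro tendsto_intros)
  show "\<exists>N. \<forall>m\<ge>N. dist ((T ^^ k) (approx m u)) ((T ^^ k) (approx n u)) \<le> e n"
    using approx_close by blast
qed

lemma measurable_param: "param \<in> measurable unit_lebesgue (restrict_space borel X)"
proof (rule measurable_restrict_space2)
  show "param \<in> space unit_lebesgue \<rightarrow> X"
    using param_in orbit_closure_subset by blast
  have "approx n \<in> borel_measurable unit_lebesgue" for n
  proof -
    have "(\<lambda>u. nat \<lfloor>u * real (p n)\<rfloor>) \<in> measurable lborel (count_space UNIV)" by measurable
    then have "(\<lambda>u. nat \<lfloor>u * real (p n)\<rfloor>) \<in> measurable unit_lebesgue (count_space UNIV)"
      by (rule measurable_restrict_space1)
    from measurable_compose[OF this, of "\<lambda>i. (T ^^ mixed_radix p n i) z" borel]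
    show ?thesis by (simp add: approx_def[abs_def])
  qed
  then show "param \<in> borel_measurable unit_lebesgue"
    by (rule borel_measurable_LIMSEQ_metric) (rule approx_tendsto)
qed

definition odometer_measure :: "'a measure" where
  "odometer_measure = distr unit_lebesgue (restrict_space borel X) param"

lemma sets_odometer_measure: "sets odometer_measure = sets (restrict_space borel X)"
  by (simp add: odometer_measure_def)

lemma prob_space_odometer_measure: "prob_space odometer_measure"
  unfolding odometer_measure_def
  by (rule prob_space.prob_space_distr[OF prob_space_unit_lebesgue measurable_param])

lemma orbit_closure_sets: "orbit_closure \<in> sets (restrict_space borel X)"
  using closed_orbit_closure orbit_closure_subset closed unfolding sets_restrict_space by auto

lemma odometer_measure_orbit_closure: "emeasure odometer_measure orbit_closure = 1"
proof -
  interpret U: prob_space unit_lebesgue by (rule prob_space_unit_lebesgue)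
  have "emeasure odometer_measure orbit_closure = emeasure unit_lebesgue (param -` orbit_closure \<inter> space unit_lebesgue)"
    unfolding odometer_measure_def by (rule emeasure_distr[OF measurable_param orbit_closure_sets])
  also have "param -` orbit_closure \<inter> space unit_lebesgue = space unit_lebesgue"
    using param_in by auto
  finally show ?thesis by (simp only: U.emeasure_space_1)
qed

text \<open>Replacing \<open>param\<close> by the step function \<open>approx n\<close> costs
  \<open>L * e n\<close>. The integral of the step function is exactly the average from
  \<open>(T ^^ k) z\<close>, because \<open>mixed_radix\<close> permutes the times below
  \<open>p n\<close>. Moving the starting point to \<open>z\<close> costs another
  \<open>L * e n\<close>.\<close>

lemma odometer_measure_integral_close:
  assumes g: "L-lipschitz_on X g"
  shows "\<bar>(\<integral>x. g ((T ^^ k) x) \<partial>odometer_measure) - average n g z\<bar> \<le> 2 * L * e n"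
proof -
  interpret U: prob_space unit_lebesgue by (rule prob_space_unit_lebesgue)
  have gc: "continuous_on X (\<lambda>x. g ((T ^^ k) x))"
    by (intro continuous_on_comp_funpow lipschitz_on_continuous_on[OF g])
  have gm: "(\<lambda>x. g ((T ^^ k) x)) \<in> borel_measurable (restrict_space borel X)"
    by (rule borel_measurable_cont[OF refl gc])
  define h where "h i = g ((T ^^ k) ((T ^^ mixed_radix p n i) z))" for i
  have "(\<integral>x. g ((T ^^ k) x) \<partial>odometer_measure) = (\<integral>u. g ((T ^^ k) (param u)) \<partial>unit_lebesgue)"
    unfolding odometer_measure_def by (rule integral_distr[OF measurable_param gm])
  moreover have "\<bar>(\<integral>u. g ((T ^^ k) (param u)) \<partial>unit_lebesgue) - average n g ((T ^^ k) z)\<bar> \<le> L * e n"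
  proof -
    have "(\<integral>u. h (nat \<lfloor>u * real (p n)\<rfloor>) \<partial>unit_lebesgue) = (\<Sum>i<p n. h i) / real (p n)"
      by (rule integral_floor_unit_lebesgue[OF p_pos])
    also have "(\<Sum>i<p n. h i) = (\<Sum>i<p n. g ((T ^^ k) ((T ^^ i) z)))"
      unfolding h_def
      by (rule sum.reindex_bij_betw[OF mixed_radix_bij, of p, OF p_pos p_dvd])
    also have "\<dots> = (\<Sum>i<p n. g ((T ^^ i) ((T ^^ k) z)))"
      by (simp add: add.commute funpow_add[THEN fun_cong, simplified, symmetric])
    finally have avg: "(\<integral>u. h (nat \<lfloor>u * real (p n)\<rfloor>) \<partial>unit_lebesgue) = average n g ((T ^^ k) z)" .
    have "\<bar>g ((T ^^ k) (param u)) - h (nat \<lfloor>u * real (p n)\<rfloor>)\<bar> \<le> L * e n" for u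
    proof -
      have "param u \<in> X" "approx n u \<in> X"
        using param_in approx_in orbit_closure_subset by blast+
      then have "dist (g ((T ^^ k) (param u))) (g ((T ^^ k) (approx n u))) \<le>
          L * dist ((T ^^ k) (param u)) ((T ^^ k) (approx n u))"
        by (intro lipschitz_onD[OF g] funpow_in)
      also have "\<dots> \<le> L * e n"
        by (rule mult_left_mono[OF param_close lipschitz_on_nonneg[OF g]])
      finally show ?thesis by (simp add: h_def approx_def dist_real_def)
    qed
    then have bound: "g ((T ^^ k) (param u)) \<le> h (nat \<lfloor>u * real (p n)\<rfloor>) + L * e n"
      "h (nat \<lfloor>u * real (p n)\<rfloor>) - L * e n \<le> g ((T ^^ k) (param u))" for u
      by (simp_all add: abs_le_iff algebra_simps)
    have ig: "integrable unit_lebesgue (\<lambda>u. g ((T ^^ k) (param u)))"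
      using integrable_cont[OF prob_space_odometer_measure sets_odometer_measure gc]
      unfolding odometer_measure_def by (rule integrable_distr[OF measurable_param])
    have ih: "integrable unit_lebesgue (\<lambda>u. h (nat \<lfloor>u * real (p n)\<rfloor>))"
    proof -
      have "bounded ((\<lambda>x. g ((T ^^ k) x)) ` X)"
        by (rule compact_imp_bounded[OF compact_continuous_image[OF gc compact]])
      then obtain b where b: "\<And>x. x \<in> X \<Longrightarrow> norm (g ((T ^^ k) x)) \<le> b"
        by (auto simp: bounded_iff)
      have "(\<lambda>u. nat \<lfloor>u * real (p n)\<rfloor>) \<in> measurable lborel (count_space UNIV)" by measurable
      then have "(\<lambda>u. nat \<lfloor>u * real (p n)\<rfloor>) \<in> measurable unit_lebesgue (count_space UNIV)"
        by (rule measurable_restrict_space1)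
      from measurable_compose[OF this, of h borel]
      show ?thesis
        using b[OF funpow_in[OF z]]
        by (intro U.integrable_const_bound[where B = b] AE_I2) (auto simp: h_def)
    qed
    have "(\<integral>u. g ((T ^^ k) (param u)) \<partial>unit_lebesgue) \<le> (\<integral>u. h (nat \<lfloor>u * real (p n)\<rfloor>) + L * e n \<partial>unit_lebesgue)"
      "(\<integral>u. h (nat \<lfloor>u * real (p n)\<rfloor>) - L * e n \<partial>unit_lebesgue) \<le> (\<integral>u. g ((T ^^ k) (param u)) \<partial>unit_lebesgue)"
      by (intro integral_mono ig ih bound Bochner_Integration.integrable_add
          Bochner_Integration.integrable_diff U.integrable_const)+
    then show ?thesis
      unfolding Bochner_Integration.integral_add[OF ih U.integrable_const]
        Bochner_Integration.integral_diff[OF ih U.integrable_const] avg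
      using U.prob_space by (simp add: abs_le_iff)
  qed
  moreover have "\<bar>average n g ((T ^^ k) z) - average n g z\<bar> \<le> L * e n"
    by (rule average_close[OF g orbit_subset_orbit_closure])
  ultimately show ?thesis by linarith
qed

text \<open>The integrals of \<open>g\<close> and of \<open>g\<close> composed with
  \<open>T\<close>, the cases \<open>k = 0\<close> and \<open>k = 1\<close> of the preceding
  estimate, are limits of the same averages; Lipschitz functions determine the measure.\<close>

lemma odometer_measure_invariant: "odometer_measure \<in> invariant_measures X T"
proof -
  let ?\<nu> = odometer_measure
  note T = measurable_T[OF sets_odometer_measure]
  have sp: "space ?\<nu> = X"
    by (simp add: odometer_measure_def space_restrict_space)
  have "distr ?\<nu> ?\<nu> T = ?\<nu>"
  proof (rule prob_measure_eqI_lipschitz[OF closed])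
    show "prob_space (distr ?\<nu> ?\<nu> T)"
      by (rule prob_space.prob_space_distr[OF prob_space_odometer_measure T])
    fix g :: "'a \<Rightarrow> real" and L assume g: "L-lipschitz_on X g"
    have "integral\<^sup>L (distr ?\<nu> ?\<nu> T) g = (\<integral>x. g (T x) \<partial>?\<nu>)"
      by (intro integral_distr[OF T] borel_measurable_cont[OF sets_odometer_measure]
          lipschitz_on_continuous_on[OF g])
    also have "\<dots> = integral\<^sup>L ?\<nu> g"
      using odometer_measure_integral_close[OF g, of 1] odometer_measure_integral_close[OF g, of 0]
      by (intro eq_if_close) simp_all
    finally show "integral\<^sup>L (distr ?\<nu> ?\<nu> T) g = integral\<^sup>L ?\<nu> g" .
  qed (simp_all add: prob_space_odometer_measure sets_odometer_measure)
  then have "emeasure ?\<nu> (T -` A \<inter> X) = emeasure ?\<nu> A" if "A \<in> sets ?\<nu>" for A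
    using emeasure_distr[OF T that] sp by simp
  then show ?thesis
    by (simp add: invariant_measures_def prob_space_odometer_measure sets_odometer_measure)
qed

text \<open>Unique ergodicity implies ergodicity: the normalised restriction to an invariant set
  \<open>A\<close> of positive mass is again invariant and lives on the orbit closure. Hence it is
  the measure itself, and \<open>A\<close> has mass 1.\<close>

lemma odometer_measure_ergodic: "ergodic_measure X T odometer_measure"
  unfolding ergodic_measure_def
proof (intro conjI ballI impI odometer_measure_invariant)
  let ?\<nu> = odometer_measure
  interpret N: prob_space ?\<nu> by (rule prob_space_odometer_measure)
  note inv = invariant_measureD[OF odometer_measure_invariant]
  fix A assume A: "A \<in> sets ?\<nu>" and TA: "T -` A \<inter> X = A"
  show "emeasure ?\<nu> A = 0 \<or> emeasure ?\<nu> A = 1"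
  proof (cases "emeasure ?\<nu> A = 0")
    case False
    let ?\<kappa> = "uniform_measure ?\<nu> A"
    have ZA: "orbit_closure \<in> sets ?\<nu>"
      using orbit_closure_sets by (simp add: sets_odometer_measure)
    have AZ: "emeasure ?\<nu> (A \<inter> orbit_closure) = emeasure ?\<nu> A"
    proof -
      have "AE x in ?\<nu>. x \<in> orbit_closure"
        using odometer_measure_orbit_closure N.AE_in_set_eq_1[OF ZA] N.emeasure_eq_measure by simp
      then show ?thesis
        using A ZA by (intro emeasure_eq_AE) auto
    qed
    have "?\<kappa> \<in> invariant_measures X T"
      unfolding invariant_measures_def
    proof (intro CollectI conjI ballI)
      show "sets ?\<kappa> = sets (restrict_space borel X)"
        by (simp add: sets_odometer_measure)
      show "prob_space ?\<kappa>"
        using False by (intro prob_space_uniform_measure) auto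
      fix B assume "B \<in> sets ?\<kappa>"
      then have B: "B \<in> sets ?\<nu>" by simp
      have TB: "T -` B \<inter> X \<in> sets ?\<nu>"
        using measurable_sets[OF measurable_T[OF inv(2)] B] inv(3) by simp
      have "emeasure ?\<nu> (A \<inter> (T -` B \<inter> X)) = emeasure ?\<nu> (T -` (A \<inter> B) \<inter> X)"
        using TA by (intro arg_cong[where f = "emeasure ?\<nu>"]) auto
      also have "\<dots> = emeasure ?\<nu> (A \<inter> B)"
        using odometer_measure_invariant sets.Int[OF A B] unfolding invariant_measures_def by blast
      finally show "emeasure ?\<kappa> (T -` B \<inter> X) = emeasure ?\<kappa> B"
        using A B TB by simp
    qed
    moreover have "emeasure ?\<kappa> orbit_closure = 1"
      using A ZA AZ False by (simp add: divide_self N.emeasure_eq_measure ennreal_divide_self)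
    ultimately have "?\<kappa> = ?\<nu>"
      using invariant_measure_unique odometer_measure_invariant odometer_measure_orbit_closure by blast
    moreover have "emeasure ?\<kappa> A = 1"
      using A False by (simp add: N.emeasure_eq_measure ennreal_divide_self)
    ultimately show ?thesis by simp
  qed simp
qed

lemma supported_on_odometer_measure: "supported_on_odometer X T odometer_measure"
  unfolding supported_on_odometer_def
  using closed_orbit_closure orbit_closure_subset orbit_closure_invariant odometer_measure_orbit_closure odometer_orbit_closure by blast

end

section \<open>From periodic pseudo-orbits to odometers\<close>

lemma periodic_mult:
  fixes q :: "nat \<Rightarrow> 'b"
  assumes "\<And>i. q (i + p) = q i"
  shows "q (i + j * p) = q i"
proof (induction j)
  case (Suc j)
  then show ?case using assms[of "i + j * p"] by (simp add: ac_simps)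
qed simp

context compact_system
begin

text \<open>The order of quantifiers matters: \<open>\<delta>\<close> depends on
  \<open>\<epsilon>\<close> alone, while the new precision \<open>\<eta>\<close> is arbitrary. A
  tracing point sampled at multiples of \<open>p\<close> has two \<open>\<eta>\<close>-close samples
  by compactness. Repeating the orbit piece between them gives a pseudo-orbit whose only jumps are
  at the closing times.\<close>

lemma shadowing_return:
  assumes shadow: "shadowing_property X T" and "\<epsilon> > 0"
  shows "\<exists>\<delta>>0. \<forall>q p \<eta>. pseudo_orbit X T \<delta> q \<longrightarrow> p > 0 \<longrightarrow> (\<forall>i. q (i + p) = q i) \<longrightarrow> \<eta> > 0 \<longrightarrow>
    (\<exists>q' p'. pseudo_orbit X T \<eta> q' \<and> p' > 0 \<and> (\<forall>i. q' (i + p') = q' i) \<and> p dvd p' \<and>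
      (\<forall>i. dist (q' i) (q i) < \<epsilon>))"
proof -
  obtain \<delta> where "\<delta> > 0" and \<delta>: "\<And>q. pseudo_orbit X T \<delta> q \<Longrightarrow> \<exists>y\<in>X. traced_by T \<epsilon> q y"
    using assms unfolding shadowing_property_def by blast
  have "\<exists>q' p'. pseudo_orbit X T \<eta> q' \<and> p' > 0 \<and> (\<forall>i. q' (i + p') = q' i) \<and> p dvd p' \<and>
      (\<forall>i. dist (q' i) (q i) < \<epsilon>)"
    if q: "pseudo_orbit X T \<delta> q" and p: "p > 0" and per: "\<forall>i. q (i + p) = q i" and \<eta>: "\<eta> > 0"
    for q :: "nat \<Rightarrow> 'a" and p and \<eta>
  proof -
    obtain y where y: "y \<in> X" "\<And>n. dist ((T ^^ n) y) (q n) < \<epsilon>"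
      using \<delta>[OF q] unfolding traced_by_def by blast
    have "\<forall>j. (T ^^ (j * p)) y \<in> X"
      using funpow_in[OF y(1)] by blast
    then obtain l r where r: "strict_mono r" and l: "((\<lambda>j. (T ^^ (j * p)) y) \<circ> r) \<longlonglongrightarrow> l"
      using compact_imp_seq_compact[OF compact] unfolding seq_compact_def by metis
    obtain N where N: "\<And>m n. m \<ge> N \<Longrightarrow> n \<ge> N \<Longrightarrow> dist ((T ^^ (r m * p)) y) ((T ^^ (r n * p)) y) < \<eta>"
      using metric_CauchyD[OF LIMSEQ_imp_Cauchy[OF l] \<eta>] by auto
    define a b where "a = r N" and "b = r (Suc N)"
    have ab: "a < b" "dist ((T ^^ (b * p)) y) ((T ^^ (a * p)) y) < \<eta>"
      using strict_monoD[OF r, of N "Suc N"] N[of "Suc N" N] by (auto simp: a_def b_def)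
    define w where "w = (T ^^ (a * p)) y"
    define p' where "p' = (b - a) * p"
    define q' where "q' i = (T ^^ (i mod p')) w" for i
    have w: "w \<in> X" unfolding w_def by (rule funpow_in[OF y(1)])
    have p': "p' > 0" using ab p by (simp add: p'_def)
    have "p' + a * p = b * p"
      using ab by (simp add: p'_def flip: distrib_right)
    then have ret: "(T ^^ p') w = (T ^^ (b * p)) y"
      unfolding w_def by (metis comp_apply funpow_add)
    show ?thesis
    proof (intro exI[of _ q'] exI[of _ p'] conjI allI)
      show "pseudo_orbit X T \<eta> q'"
        unfolding pseudo_orbit_def
      proof (intro conjI allI)
        show "q' n \<in> X" for n
          unfolding q'_def by (rule funpow_in[OF w])
        show "dist (T (q' n)) (q' (Suc n)) < \<eta>" for n
        proof (cases "Suc (n mod p') = p'")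
          case True
          then have "T (q' n) = (T ^^ p') w"
            by (metis comp_apply funpow.simps(2) q'_def)
          then show ?thesis
            using True ab(2) unfolding ret by (simp add: q'_def mod_Suc w_def)
        next
          case False
          then show ?thesis using \<eta> by (simp add: q'_def mod_Suc)
        qed
      qed
      show "dist (q' i) (q i) < \<epsilon>" for i
      proof -
        have "q' i = (T ^^ (i mod p' + a * p)) y"
          by (simp add: q'_def w_def funpow_add)
        \<comment> \<open>Both \<open>p'\<close> and the delay \<open>a * p\<close> are multiples of
          \<open>p\<close>, so the repeated piece stays in phase with \<open>q\<close>.\<close>
        moreover have "q (i mod p' + a * p) = q i"
        proof -
          have "q i = q (i mod p' + (i div p' * (b - a)) * p)"
            by (metis mod_div_mult_eq mult.assoc p'_def)
          then show ?thesis using per by (simp add: periodic_mult)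
        qed
        ultimately show ?thesis using y(2)[of "i mod p' + a * p"] by simp
      qed
    qed (use p' in \<open>simp_all add: q'_def p'_def\<close>)
  qed
  with \<open>\<delta> > 0\<close> show ?thesis by blast
qed

text \<open>Closing up repeatedly with tolerances \<open>\<epsilon> / 2 ^ Suc n\<close> gives
  periodic pseudo-orbits \<open>Q n\<close> that converge uniformly in time; the limit is within
  \<open>\<epsilon> / 2 ^ n\<close> of \<open>Q n\<close>. Times congruent modulo \<open>P n\<close>
  have the same value of \<open>Q n\<close>, which yields recurrence with twice that error.\<close>

lemma shadowing_uniformly_recurrent:
  assumes shadow: "shadowing_property X T" and "\<epsilon> > 0"
  shows "\<exists>\<delta>>0. \<forall>q p. pseudo_orbit X T \<delta> q \<longrightarrow> p > 0 \<longrightarrow> (\<forall>i. q (i + p) = q i) \<longrightarrow>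
    (\<exists>z P e. uniformly_recurrent X T z P e \<and> P 0 = p \<and> e 0 \<le> 2 * \<epsilon> \<and> (\<forall>i. dist ((T ^^ i) z) (q i) \<le> \<epsilon>))"
proof -
  have "\<forall>n. \<exists>\<delta>>0. \<forall>q p \<eta>. pseudo_orbit X T \<delta> q \<longrightarrow> p > 0 \<longrightarrow> (\<forall>i. q (i + p) = q i) \<longrightarrow> \<eta> > 0 \<longrightarrow>
    (\<exists>q' p'. pseudo_orbit X T \<eta> q' \<and> p' > 0 \<and> (\<forall>i. q' (i + p') = q' i) \<and> p dvd p' \<and>
      (\<forall>i. dist (q' i) (q i) < \<epsilon> / 2 ^ Suc n))"
    using \<open>\<epsilon> > 0\<close> by (intro allI shadowing_return[OF shadow]) simp
  then obtain \<delta> where \<delta>_pos: "\<And>n. \<delta> n > 0" and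
    \<delta>: "\<And>n q p \<eta>. pseudo_orbit X T (\<delta> n) q \<Longrightarrow> p > 0 \<Longrightarrow> (\<forall>i. q (i + p) = q i) \<Longrightarrow> \<eta> > 0 \<Longrightarrow>
      \<exists>q' p'. pseudo_orbit X T \<eta> q' \<and> p' > 0 \<and> (\<forall>i. q' (i + p') = q' i) \<and> p dvd p' \<and>
      (\<forall>i. dist (q' i) (q i) < \<epsilon> / 2 ^ Suc n)"
    by metis
  \<comment> \<open>The bound \<open>\<delta> n\<close> permits the next closing step; the bound
    \<open>(1 / 2) ^ n\<close> makes the jumps vanish, so that the limit is a true orbit.\<close>
  define D where "D n = min (\<delta> n) ((1 / 2) ^ n)" for n
  have D_pos: "D n > 0" for n using \<delta>_pos by (simp add: D_def)
  have "\<exists>z P e. uniformly_recurrent X T z P e \<and> P 0 = p \<and> e 0 \<le> 2 * \<epsilon> \<and> (\<forall>i. dist ((T ^^ i) z) (q i) \<le> \<epsilon>)"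
    if q: "pseudo_orbit X T (D 0) q" and p: "p > 0" and per: "\<forall>i. q (i + p) = q i" for q :: "nat \<Rightarrow> 'a" and p
  proof -
    \<comment> \<open>The last conjunct fixes the initial pair: the first period is then
      \<open>p\<close>, and the limit follows \<open>q\<close> itself.\<close>
    define good where "good n x \<longleftrightarrow> pseudo_orbit X T (D n) (fst x) \<and> snd x > 0 \<and>
      (\<forall>i. fst x (i + snd x) = fst x i) \<and> (n = 0 \<longrightarrow> x = (q, p))" for n and x :: "(nat \<Rightarrow> 'a) \<times> nat"
    have "\<exists>F. \<forall>n. good n (F n) \<and> (snd (F n) dvd snd (F (Suc n)) \<and>
      (\<forall>i. dist (fst (F (Suc n)) i) (fst (F n) i) < \<epsilon> / 2 ^ Suc n))"
    proof (rule dependent_nat_choice)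
      show "\<exists>x. good 0 x" using q p per by (auto simp: good_def)
      fix x n assume "good n x"
      moreover from this have "pseudo_orbit X T (\<delta> n) (fst x)"
        by (auto simp: good_def pseudo_orbit_def D_def)
      ultimately obtain q' p' where "pseudo_orbit X T (D (Suc n)) q'" "p' > 0" "\<forall>i. q' (i + p') = q' i"
        "snd x dvd p'" "\<forall>i. dist (q' i) (fst x i) < \<epsilon> / 2 ^ Suc n"
        using \<delta>[of n "fst x" "snd x" "D (Suc n)"] D_pos unfolding good_def by blast
      then show "\<exists>y. good (Suc n) y \<and> (snd x dvd snd y \<and> (\<forall>i. dist (fst y i) (fst x i) < \<epsilon> / 2 ^ Suc n))"
        by (intro exI[of _ "(q', p')"]) (simp add: good_def)
    qed
    then obtain F where F: "\<And>n. good n (F n)" "\<And>n. snd (F n) dvd snd (F (Suc n))"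
      "\<And>n i. dist (fst (F (Suc n)) i) (fst (F n) i) < \<epsilon> / 2 ^ Suc n" by blast
    define Q P where "Q n = fst (F n)" and "P n = snd (F n)" for n
    have Q: "pseudo_orbit X T (D n) (Q n)" "P n > 0" "\<And>i. Q n (i + P n) = Q n i" "P n dvd P (Suc n)"
      "\<And>i. dist (Q (Suc n) i) (Q n i) < \<epsilon> / 2 ^ Suc n" for n
      using F(1)[of n] F(2,3) by (auto simp: Q_def P_def good_def)
    have Q0: "Q 0 = q" "P 0 = p" using F(1)[of 0] by (auto simp: Q_def P_def good_def)
    \<comment> \<open>The subtracted term is the part of the geometric series still unspent; it
      makes the induction on \<open>m\<close> close.\<close>
    have "dist (Q m i) (Q n i) \<le> \<epsilon> / 2 ^ n - \<epsilon> / 2 ^ m" if "n \<le> m" for n m i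
      using that
    proof (induction m rule: dec_induct)
      case (step m)
      then show ?case
        using Q(5)[of m i] dist_triangle[of "Q (Suc m) i" "Q n i" "Q m i"] by simp
    qed simp
    then have tail: "dist (Q m i) (Q n i) \<le> \<epsilon> / 2 ^ n" if "n \<le> m" for n m i
      using that \<open>\<epsilon> > 0\<close> by (smt (verit) divide_nonneg_nonneg zero_le_power)
    have lim0: "(\<lambda>n. c / 2 ^ n) \<longlonglongrightarrow> 0" for c :: real
      using LIMSEQ_divide_realpow_zero[of 2 c] by simp
    have QX: "Q n i \<in> X" for n i using Q(1) by (auto simp: pseudo_orbit_def)
    have "\<exists>l\<in>X. (\<lambda>n. Q n i) \<longlonglongrightarrow> l" for i
    proof -
      have "Cauchy (\<lambda>n. Q n i)" by (rule Cauchy_tail_bound[OF tail lim0])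
      then show ?thesis
        using completeE[OF compact_imp_complete[OF compact], of "\<lambda>n. Q n i"] QX by metis
    qed
    then obtain r where r: "\<And>i. r i \<in> X" "\<And>i. (\<lambda>n. Q n i) \<longlonglongrightarrow> r i" by metis
    have rQ: "dist (r i) (Q n i) \<le> \<epsilon> / 2 ^ n" for n i
      by (rule LIMSEQ_le_const2[OF tendsto_dist[OF r(2) tendsto_const]]) (use tail in blast)
    have step: "r (Suc i) = T (r i)" for i
    proof -
      have "(\<lambda>n. T (Q n i)) \<longlonglongrightarrow> T (r i)"
        by (rule continuous_on_tendsto_compose[OF cont r(2)]) (use QX r(1) in auto)
      then have "(\<lambda>n. dist (T (Q n i)) (Q n (Suc i))) \<longlonglongrightarrow> dist (T (r i)) (r (Suc i))"
        by (intro tendsto_dist r(2))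
      moreover have "(\<lambda>n. dist (T (Q n i)) (Q n (Suc i))) \<longlonglongrightarrow> 0"
      proof (rule Lim_null_comparison[OF _ lim0[of 1]])
        have "dist (T (Q n i)) (Q n (Suc i)) \<le> 1 / 2 ^ n" for n
          using Q(1)[of n] unfolding pseudo_orbit_def D_def
          by (smt (verit) power_one_over)
        then show "\<forall>\<^sub>F n in sequentially. norm (dist (T (Q n i)) (Q n (Suc i))) \<le> 1 / 2 ^ n"
          by simp
      qed
      ultimately have "dist (T (r i)) (r (Suc i)) = 0" by (rule LIMSEQ_unique)
      then show ?thesis by simp
    qed
    have orbit: "(T ^^ i) (r 0) = r i" for i
      by (induction i) (simp_all add: step)
    show ?thesis
    proof (intro exI[of _ "r 0"] exI[of _ P] exI[of _ "\<lambda>n. 2 * \<epsilon> / 2 ^ n"] conjI allI)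
      show "uniformly_recurrent X T (r 0) P (\<lambda>n. 2 * \<epsilon> / 2 ^ n)"
      proof
        show "dist ((T ^^ (i + j * P n)) (r 0)) ((T ^^ i) (r 0)) \<le> 2 * \<epsilon> / 2 ^ n" for i j n
          using rQ[of "i + j * P n" n] rQ[of i n]
            dist_triangle2[of "r (i + j * P n)" "r i" "Q n i"] periodic_mult[of "Q n", OF Q(3)]
          by (simp add: orbit)
      qed (use r Q lim0 in auto)
      show "P 0 = p" by (rule Q0)
      show "2 * \<epsilon> / 2 ^ 0 \<le> 2 * \<epsilon>" by simp
      show "dist ((T ^^ i) (r 0)) (q i) \<le> \<epsilon>" for i
        using rQ[of i 0] by (simp add: orbit Q0)
    qed
  qed
  with D_pos[of 0] show ?thesis by blast
qed

end

section \<open>From invariant measures to periodic pseudo-orbits\<close>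

lemma sum_list_concat_replicate:
  fixes g :: "'b \<Rightarrow> real"
  shows "(\<Sum>x\<leftarrow>concat (map (\<lambda>i. replicate (n i) (c i)) [0..<m]). g x) = (\<Sum>i<m. real (n i) * g (c i))"
  by (induction m) (simp_all add: sum_list_replicate)

section \<open>Supports, and approximation of a measure by finite averages\<close>

context compact_system
begin

text \<open>The family intersected may be uncountable, so full measure needs compactness: a closed
  set missing the support is covered by finitely many null complements. The complement of the
  support is a countable union of such sets, by distance. Forward invariance holds because the
  preimage of the support is again a closed set of measure 1.\<close>

lemma support_props:
  assumes inv: "\<mu> \<in> invariant_measures X T"
  shows "closed (support X \<mu>)" "support X \<mu> \<subseteq> X" "emeasure \<mu> (support X \<mu>) = 1"
    "T ` support X \<mu> \<subseteq> support X \<mu>"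
proof -
  note inv' = invariant_measureD[OF inv]
  interpret prob_space \<mu> by (rule inv')
  let ?K = "support X \<mu>"
  define \<C> where "\<C> = {C. closed C \<and> C \<subseteq> X \<and> emeasure \<mu> C = 1}"
  have K: "?K = \<Inter>\<C>" by (simp add: support_def \<C>_def)
  have closed_sets: "C \<in> sets \<mu>" if "closed C" "C \<subseteq> X" for C
    using that unfolding inv'(2) sets_restrict_space by (intro image_eqI[of _ _ C]) auto
  have "X \<in> \<C>"
    using emeasure_space_1 closed by (simp add: \<C>_def inv'(3))
  then show KX: "?K \<subseteq> X" unfolding K by blast
  show cK: "closed ?K" unfolding K by (auto simp: \<C>_def)
  have null: "emeasure \<mu> C = 0" if C: "closed C" "C \<subseteq> X" "C \<inter> ?K = {}" for C
  proof -
    have "compact C"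
      using C compact closed_Int_compact[of C X] by (simp add: Int_absorb2)
    moreover have "C \<subseteq> \<Union>(uminus ` \<C>)"
      using C(3) unfolding K by blast
    moreover have "open B" if "B \<in> uminus ` \<C>" for B
      using that by (auto simp: \<C>_def)
    ultimately obtain \<F> where \<F>: "\<F> \<subseteq> uminus ` \<C>" "finite \<F>" "C \<subseteq> \<Union>\<F>"
      by (rule compactE)
    have "X \<inter> D \<in> null_sets \<mu>" if "D \<in> \<F>" for D
    proof -
      from that \<F>(1) obtain E where E: "E \<in> \<C>" "D = - E" by blast
      then have "E \<in> sets \<mu>" "prob E = 1"
        using closed_sets by (auto simp: \<C>_def measure_def)
      then have "prob (space \<mu> - E) = 0" by (simp add: prob_compl)
      moreover have "X \<inter> D = space \<mu> - E" using E inv'(3) by auto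
      ultimately show ?thesis
        using \<open>E \<in> sets \<mu>\<close> by (auto simp: null_sets_def emeasure_eq_measure)
    qed
    then have "(\<Union>D\<in>\<F>. X \<inter> D) \<in> null_sets \<mu>"
      using \<F>(2) by (intro null_sets.finite_UN) auto
    moreover have "C \<subseteq> (\<Union>D\<in>\<F>. X \<inter> D)" using \<F>(3) C(2) by blast
    ultimately show ?thesis
      using null_sets_subset closed_sets[OF C(1,2)] by (metis null_setsD1)
  qed
  have Kne: "?K \<noteq> {}"
    using null[OF closed] emeasure_space_1 inv'(3) by auto
  have "(\<Union>n. {x \<in> X. inverse (real (Suc n)) \<le> infdist x ?K}) \<in> null_sets \<mu>"
  proof (rule null_sets_UN)
    fix n
    have c: "closed {x \<in> X. inverse (real (Suc n)) \<le> infdist x ?K}" (is "closed ?C")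
      by (intro continuous_on_closed_Collect_le closed continuous_intros)
    moreover have "?C \<inter> ?K = {}" by auto
    ultimately show "?C \<in> null_sets \<mu>"
      using null[of ?C] closed_sets[of ?C] by (auto simp: null_sets_def)
  qed
  moreover have "(\<Union>n. {x \<in> X. inverse (real (Suc n)) \<le> infdist x ?K}) = space \<mu> - ?K"
  proof (intro equalityI subsetI)
    fix x assume x: "x \<in> space \<mu> - ?K"
    then have "infdist x ?K > 0"
      using cK Kne in_closed_iff_infdist_zero infdist_nonneg[of x ?K] by (metis DiffD2 less_eq_real_def)
    then obtain n where "inverse (real (Suc n)) < infdist x ?K"
      using reals_Archimedean by blast
    then show "x \<in> (\<Union>n. {x \<in> X. inverse (real (Suc n)) \<le> infdist x ?K})"
      using x inv'(3) by (auto intro: less_imp_le)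
  qed (auto simp: inv'(3))
  ultimately have "emeasure \<mu> (space \<mu> - ?K) = 0" by auto
  then have "prob (space \<mu> - ?K) = 0" by (simp add: measure_def)
  then show K1: "emeasure \<mu> ?K = 1"
    using closed_sets[OF cK KX] by (simp add: prob_compl emeasure_eq_measure)
  have "X \<inter> T -` ?K \<in> \<C>"
    using continuous_closed_preimage[OF cont closed cK] inv closed_sets[OF cK KX] K1
    by (auto simp: \<C>_def invariant_measures_def Int_commute)
  then show "T ` ?K \<subseteq> ?K" unfolding K by blast
qed

text \<open>The points of the list are the centres of a finite cover, repeated proportionally to the
  mass of their cells.\<close>

lemma integral_approx_average:
  assumes M: "prob_space \<mu>" "sets \<mu> = sets (restrict_space borel X)"
    and K: "closed K" "K \<subseteq> X" "emeasure \<mu> K = 1"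
    and "\<rho> > 0" "\<eta> > 0"
  shows "\<exists>xs. xs \<noteq> [] \<and> set xs \<subseteq> K \<and> (\<forall>g. continuous_on X g \<longrightarrow> (\<forall>x\<in>X. \<bar>g x\<bar> \<le> 1) \<longrightarrow>
    (\<forall>x\<in>K. \<forall>y\<in>K. dist x y < \<rho> \<longrightarrow> \<bar>g x - g y\<bar> \<le> \<eta>) \<longrightarrow>
    \<bar>integral\<^sup>L \<mu> g - (\<Sum>x\<leftarrow>xs. g x) / length xs\<bar> \<le> 2 * \<eta>)"
proof -
  interpret prob_space \<mu> by (rule M)
  have cK: "compact K"
    using K compact closed_Int_compact[of K X] by (simp add: Int_absorb2)
  obtain k where k: "finite k" "k \<subseteq> K" "K \<subseteq> (\<Union>x\<in>k. ball x \<rho>)"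
    using seq_compact_imp_totally_bounded[OF compact_imp_seq_compact[OF cK], rule_format, OF \<open>\<rho> > 0\<close>]
    by (elim exE conjE) (rule that)
  obtain cs where cs: "set cs = k" using finite_list[OF k(1)] by blast
  define m where "m = length cs"
  define c where "c i = cs ! i" for i
  have c_in: "c i \<in> K" if "i < m" for i
    using that k(2) nth_mem[of i cs] by (auto simp: c_def m_def cs)
  have "K \<noteq> {}" using K(3) by auto
  then have "k \<noteq> {}" using k(3) by auto
  then have m: "m > 0" using cs by (auto simp: m_def)
  \<comment> \<open>Disjoint cells: a point of \<open>K\<close> belongs to the first ball that
    contains it.\<close>
  define A where "A i = K \<inter> ball (c i) \<rho> - (\<Union>j<i. ball (c j) \<rho>)" for i
  have A_sets: "A i \<in> sets \<mu>" for i
  proof -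
    have "A i \<in> sets borel"
      unfolding A_def using K(1) by (intro sets.Diff sets.Int sets.finite_UN borel_closed borel_open) simp_all
    moreover have "A i \<subseteq> X" using K(2) by (auto simp: A_def)
    ultimately show ?thesis
      unfolding M(2) sets_restrict_space by (intro image_eqI[of _ _ "A i"]) blast+
  qed
  have cell: "\<exists>i<m. x \<in> A i \<and> (\<forall>j<m. x \<in> A j \<longleftrightarrow> j = i)" if x: "x \<in> K" for x
  proof -
    have "\<exists>i<m. x \<in> ball (c i) \<rho>"
    proof -
      obtain y where "y \<in> set cs" "x \<in> ball y \<rho>" using x k(3) cs by blast
      then show ?thesis unfolding c_def m_def by (metis in_set_conv_nth)
    qed
    then have ex: "\<exists>i. i < m \<and> x \<in> ball (c i) \<rho>" by blast
    define i where "i = (LEAST i. i < m \<and> x \<in> ball (c i) \<rho>)"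
    have i: "i < m" "x \<in> ball (c i) \<rho>" using LeastI_ex[OF ex] by (simp_all add: i_def)
    have least: "x \<notin> ball (c j) \<rho>" if "j < i" for j
      using not_less_Least[of j "\<lambda>i. i < m \<and> x \<in> ball (c i) \<rho>"] that i(1) by (auto simp: i_def)
    have xi: "x \<in> A i" using x i least unfolding A_def by blast
    moreover have "j = i" if "x \<in> A j" for j
    proof (rule linorder_cases[of j i])
      assume "j < i"
      then show ?thesis using least[of j] that unfolding A_def by blast
    next
      assume "i < j"
      then show ?thesis using i(2) that unfolding A_def by blast
    qed
    ultimately show ?thesis using i(1) by blast
  qed
  have pick: "(\<Sum>i<m. h i * indicat_real (A i) x) = h i0" if "i0 < m" "\<forall>j<m. x \<in> A j \<longleftrightarrow> j = i0" for h i0 x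
  proof -
    have "(\<Sum>i<m. h i * indicat_real (A i) x) = (\<Sum>i<m. if i = i0 then h i else 0)"
      using that(2) by (intro sum.cong) (auto simp: indicator_def)
    then show ?thesis using that(1) by simp
  qed
  define w where "w i = prob (A i)" for i
  have w0: "w i \<ge> 0" for i by (simp add: w_def)
  have KM: "K \<in> sets \<mu>"
    unfolding M(2) sets_restrict_space by (rule image_eqI[of _ _ K]) (use K in auto)
  have AE_K: "AE x in \<mu>. x \<in> K"
    using K(3) AE_in_set_eq_1[OF KM] emeasure_eq_measure by simp
  have int_step: "integrable \<mu> (\<lambda>x. \<Sum>i<m. h i * indicat_real (A i) x)"
    "(\<integral>x. (\<Sum>i<m. h i * indicat_real (A i) x) \<partial>\<mu>) = (\<Sum>i<m. h i * w i)" for h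
  proof -
    have *: "integrable \<mu> (\<lambda>x. h i * indicat_real (A i) x)" for i
      using A_sets by (intro integrable_mult_right integrable_real_indicator) (auto simp: emeasure_eq_measure)
    then show "integrable \<mu> (\<lambda>x. \<Sum>i<m. h i * indicat_real (A i) x)"
      by (rule Bochner_Integration.integrable_sum)
    show "(\<integral>x. (\<Sum>i<m. h i * indicat_real (A i) x) \<partial>\<mu>) = (\<Sum>i<m. h i * w i)"
      unfolding Bochner_Integration.integral_sum[OF *] using A_sets by (simp add: w_def)
  qed
  have w_sum: "(\<Sum>i<m. w i) = 1"
  proof -
    have "(\<integral>x. (\<Sum>i<m. 1 * indicat_real (A i) x) \<partial>\<mu>) = (\<integral>x. 1 \<partial>\<mu>)"
    proof (rule integral_cong_AE)
      show "AE x in \<mu>. (\<Sum>i<m. 1 * indicat_real (A i) x) = 1"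
        using AE_K by eventually_elim (use cell pick[of _ _ "\<lambda>_. 1"] in blast)
    qed (use A_sets in auto)
    then show ?thesis using int_step(2)[of "\<lambda>_. 1"] by (simp add: prob_space)
  qed
  \<comment> \<open>\<open>N\<close> will be the length of the list. Rounding the \<open>m\<close>
    weights to multiples of \<open>1 / N\<close> changes an average of values bounded by 1 by at
    most \<open>2 * m / N\<close>, now below \<open>\<eta>\<close>.\<close>
  obtain N :: nat where N: "2 * real m / \<eta> < real N" using reals_Archimedean2 by blast
  have "0 < 2 * real m / \<eta>" using m \<open>\<eta> > 0\<close> by simp
  then have N0: "N > 0" using N by (metis less_trans of_nat_0_less_iff)
  define n where "n i = nat \<lfloor>real N * w i\<rfloor>" for i
  have n: "real (n i) \<le> real N * w i" "real N * w i \<le> real (n i) + 1" for i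
  proof -
    have "0 \<le> real N * w i" using w0 by simp
    then show "real (n i) \<le> real N * w i" "real N * w i \<le> real (n i) + 1"
      unfolding n_def by linarith+
  qed
  have Nw: "(\<Sum>i<m. real N * w i) = real N"
    by (simp add: w_sum sum_distrib_left[symmetric])
  have n_sum: "(\<Sum>i<m. real (n i)) \<le> real N"
    using sum_mono[of "{..<m}" "\<lambda>i. real (n i)" "\<lambda>i. real N * w i"] n(1) Nw by simp
  then have n_le: "(\<Sum>i<m. n i) \<le> N" by (metis of_nat_le_iff of_nat_sum)
  \<comment> \<open>Rounding down leaves at most \<open>m\<close> entries missing; copies of
    \<open>c 0\<close> bring the length to exactly \<open>N\<close>.\<close>
  define r where "r = N - (\<Sum>i<m. n i)"
  have r: "real r = real N - (\<Sum>i<m. real (n i))" using n_le by (simp add: r_def of_nat_diff)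
  have r_m: "real r \<le> real m"
    using sum_mono[of "{..<m}" "\<lambda>i. real N * w i" "\<lambda>i. real (n i) + 1"] n(2) Nw
    by (simp add: r sum.distrib)
  define xs where "xs = concat (map (\<lambda>i. replicate (n i) (c i)) [0..<m]) @ replicate r (c 0)"
  have sum_xs: "(\<Sum>x\<leftarrow>xs. g x) = (\<Sum>i<m. real (n i) * g (c i)) + real r * g (c 0)" for g :: "'a \<Rightarrow> real"
    unfolding xs_def map_append sum_list.append sum_list_concat_replicate by (simp add: sum_list_replicate)
  have "real (length xs) = (\<Sum>x\<leftarrow>xs. 1)" by (simp add: sum_list_triv)
  then have len: "length xs = N"
    using sum_xs[of "\<lambda>_. 1"] r by simp
  have "\<bar>integral\<^sup>L \<mu> g - (\<Sum>x\<leftarrow>xs. g x) / length xs\<bar> \<le> 2 * \<eta>"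
    if g: "continuous_on X g" and g1: "\<forall>x\<in>X. \<bar>g x\<bar> \<le> 1"
      and osc: "\<forall>x\<in>K. \<forall>y\<in>K. dist x y < \<rho> \<longrightarrow> \<bar>g x - g y\<bar> \<le> \<eta>" for g
  proof -
    \<comment> \<open>\<open>s\<close> takes on each cell the value of \<open>g\<close> at its
      centre, so its integral is the weighted sum over the centres. One \<open>\<eta>\<close> is
      spent on replacing \<open>g\<close> by \<open>s\<close>, the other on rounding.\<close>
    define s where "s x = (\<Sum>i<m. g (c i) * indicat_real (A i) x)" for x
    have g_int: "integrable \<mu> g" by (rule integrable_cont[OF M g])
    have s_int: "integrable \<mu> s" unfolding s_def by (rule int_step)
    have AE: "AE x in \<mu>. \<bar>g x - s x\<bar> \<le> \<eta>"
      using AE_K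
    proof eventually_elim
      fix x assume x: "x \<in> K"
      then obtain i where i: "i < m" "x \<in> A i" "\<forall>j<m. x \<in> A j \<longleftrightarrow> j = i" using cell by blast
      then have "dist x (c i) < \<rho>" by (auto simp: A_def dist_commute)
      then show "\<bar>g x - s x\<bar> \<le> \<eta>"
        using osc x c_in[OF i(1)] pick[OF i(1,3), of "\<lambda>i. g (c i)"] by (simp add: s_def)
    qed
    have "AE x in \<mu>. g x \<le> s x + \<eta>" "AE x in \<mu>. s x \<le> g x + \<eta>"
      using AE by (auto elim!: eventually_mono)
    then have "integral\<^sup>L \<mu> g \<le> (\<integral>x. s x + \<eta> \<partial>\<mu>)" "integral\<^sup>L \<mu> s \<le> (\<integral>x. g x + \<eta> \<partial>\<mu>)"
      using g_int s_int by (intro integral_mono_AE; simp)+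
    moreover have "(\<integral>x. s x + \<eta> \<partial>\<mu>) = integral\<^sup>L \<mu> s + \<eta>" "(\<integral>x. g x + \<eta> \<partial>\<mu>) = integral\<^sup>L \<mu> g + \<eta>"
      using g_int s_int by (simp_all add: prob_space)
    ultimately have 1: "\<bar>integral\<^sup>L \<mu> g - (\<Sum>i<m. g (c i) * w i)\<bar> \<le> \<eta>"
      using int_step(2)[of "\<lambda>i. g (c i)"] unfolding s_def by linarith
    have gc: "\<bar>g (c i)\<bar> \<le> 1" if "i < m" for i
      using g1 c_in[OF that] K(2) by blast
    have "real N * (\<Sum>i<m. g (c i) * w i) - (\<Sum>x\<leftarrow>xs. g x)
        = (\<Sum>i<m. g (c i) * (real N * w i - real (n i))) - real r * g (c 0)"
      by (simp add: sum_xs sum_distrib_left sum_subtractf algebra_simps)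
    moreover have "\<bar>\<Sum>i<m. g (c i) * (real N * w i - real (n i))\<bar> \<le> real r"
    proof -
      have "\<bar>\<Sum>i<m. g (c i) * (real N * w i - real (n i))\<bar> \<le> (\<Sum>i<m. real N * w i - real (n i))"
      proof (rule order_trans[OF sum_abs], rule sum_mono)
        fix i assume "i \<in> {..<m}"
        then show "\<bar>g (c i) * (real N * w i - real (n i))\<bar> \<le> real N * w i - real (n i)"
          using gc[of i] n(1)[of i] by (simp add: abs_mult mult_left_le_one_le)
      qed
      then show ?thesis using Nw by (simp add: r sum_subtractf)
    qed
    moreover have "\<bar>real r * g (c 0)\<bar> \<le> real r"
      using gc[OF m] by (simp add: abs_mult mult_left_le)
    ultimately have "\<bar>real N * (\<Sum>i<m. g (c i) * w i) - (\<Sum>x\<leftarrow>xs. g x)\<bar> \<le> 2 * real m"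
      using r_m by linarith
    also have "\<dots> \<le> \<eta> * real N"
      using N \<open>\<eta> > 0\<close> by (simp add: field_simps)
    finally have "\<bar>(\<Sum>i<m. g (c i) * w i) - (\<Sum>x\<leftarrow>xs. g x) / real N\<bar> \<le> \<eta>"
      using N0 by (simp add: abs_le_iff field_simps)
    with 1 show ?thesis unfolding len by linarith
  qed
  moreover have "xs \<noteq> []" using len N0 by auto
  moreover have "set xs \<subseteq> K" using c_in m by (auto simp: xs_def)
  ultimately show ?thesis by blast
qed

end

text \<open>The endpoint \<open>y\<close> is left out of the list, so that chains are joined by
  plain append and a loop is exactly one period of a pseudo-orbit.\<close>

definition chain_list :: "'a::metric_space set \<Rightarrow> ('a \<Rightarrow> 'a) \<Rightarrow> real \<Rightarrow> 'a \<Rightarrow> 'a list \<Rightarrow> 'a \<Rightarrow> bool" where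
  "chain_list X T \<delta> x l y \<longleftrightarrow> l \<noteq> [] \<and> hd l = x \<and> set l \<subseteq> X \<and> successively (\<lambda>u v. dist (T u) v < \<delta>) (l @ [y])"

lemma chain_list_append: "chain_list X T \<delta> x l y \<Longrightarrow> chain_list X T \<delta> y l' z \<Longrightarrow> chain_list X T \<delta> x (l @ l') z"
  by (auto simp: chain_list_def successively_append_iff)

text \<open>Moving the endpoint affects only the last jump. Chains to finitely many centres can thus
  serve all nearby endpoints.\<close>

lemma chain_list_change_end:
  assumes p: "chain_list X T \<delta> x l y" and d: "dist y y' < \<eta>"
  shows "chain_list X T (\<delta> + \<eta>) x l y'"
proof -
  have "\<eta> > 0" using d zero_le_dist[of y y'] by linarith
  have "successively (\<lambda>u v. dist (T u) v < \<delta>) l"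
    using p by (auto simp: chain_list_def successively_append_iff)
  then have "successively (\<lambda>u v. dist (T u) v < \<delta> + \<eta>) l"
    by (rule successively_mono) (use \<open>\<eta> > 0\<close> in auto)
  moreover have "dist (T (last l)) y < \<delta>"
    using p by (auto simp: chain_list_def successively_append_iff)
  ultimately show ?thesis
    using p d dist_triangle[of "T (last l)" y' y] by (auto simp: chain_list_def successively_append_iff)
qed

lemma chain_imp_chain_list:
  assumes "chain X T \<delta> n c x y"
  shows "chain_list X T \<delta> x (map c [0..<n]) y"
proof -
  have "map c [0..<n] @ [y] = map c [0..<Suc n]"
    using assms by (simp add: chain_def)
  then show ?thesis
    using assms by (auto simp: chain_list_def chain_def successively_conv_nth hd_map simp del: upt_Suc)
qed

lemma chain_list_concat_loops:
  assumes "xs \<noteq> []" "\<And>x. x \<in> set xs \<Longrightarrow> chain_list X T \<delta> b (f x) b"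
  shows "chain_list X T \<delta> b (concat (map f xs)) b"
  using assms
proof (induction xs rule: list_nonempty_induct)
  case (cons x xs)
  then show ?case using chain_list_append[of X T \<delta> b "f x" b] by simp
qed simp

text \<open>The final jump to \<open>b\<close> is the jump to the head of the next copy of
  \<open>l\<close>.\<close>

lemma loop_pseudo_orbit:
  assumes "chain_list X T \<delta> b l b"
  shows "pseudo_orbit X T \<delta> (\<lambda>i. l ! (i mod length l))"
  unfolding pseudo_orbit_def
proof (intro conjI allI)
  have l: "l \<noteq> []" "hd l = b" "set l \<subseteq> X" and s: "successively (\<lambda>u v. dist (T u) v < \<delta>) (l @ [b])"
    using assms by (auto simp: chain_list_def)
  fix n
  have lt: "n mod length l < length l" using l by simp
  then show "l ! (n mod length l) \<in> X" using l(3) nth_mem by blast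
  have "dist (T ((l @ [b]) ! (n mod length l))) ((l @ [b]) ! Suc (n mod length l)) < \<delta>"
    using successively_nth[OF s, of "n mod length l"] lt by simp
  then show "dist (T (l ! (n mod length l))) (l ! (Suc n mod length l)) < \<delta>"
    using l lt by (cases "Suc (n mod length l) = length l") (auto simp: nth_append mod_Suc hd_conv_nth)
qed

lemma sum_concat_blocks:
  fixes g G :: "'b \<Rightarrow> real"
  assumes "\<And>x. x \<in> set xs \<Longrightarrow> \<bar>(\<Sum>y\<leftarrow>f x. g y) - N * G x\<bar> \<le> D"
  shows "\<bar>(\<Sum>y\<leftarrow>concat (map f xs). g y) - N * (\<Sum>x\<leftarrow>xs. G x)\<bar> \<le> D * length xs"
  using assms
proof (induction xs)
  case (Cons x xs)
  then have "\<bar>(\<Sum>y\<leftarrow>f x. g y) - N * G x\<bar> \<le> D"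
    "\<bar>(\<Sum>y\<leftarrow>concat (map f xs). g y) - N * (\<Sum>x\<leftarrow>xs. G x)\<bar> \<le> D * length xs" by simp_all
  then show ?case by (simp add: distrib_left)
qed simp

lemma abs_sum_list_le_length:
  fixes g :: "'b \<Rightarrow> real"
  assumes "\<And>x. x \<in> set xs \<Longrightarrow> \<bar>g x\<bar> \<le> 1"
  shows "\<bar>\<Sum>x\<leftarrow>xs. g x\<bar> \<le> length xs"
  using assms by (induction xs) (auto intro: order_trans[OF abs_triangle_ineq] add_mono)

text \<open>Think of \<open>M\<close> blocks with lengths between \<open>N\<close> and
  \<open>N + D\<close>, total sum \<open>S\<close> and total length \<open>l\<close>, where
  \<open>\<Gamma>\<close> is the sum of \<open>M\<close> averages. After clearing denominators, the
  error of the sum and the error of the length contribute at most \<open>D * M * M\<close>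
  each.\<close>

lemma average_perturbation:
  fixes S \<Gamma> :: real
  assumes "\<bar>S - N * \<Gamma>\<bar> \<le> D * M" "\<bar>\<Gamma>\<bar> \<le> M" "N * M \<le> l" "l \<le> (N + D) * M" "M > 0" "N > 0"
  shows "\<bar>S / l - \<Gamma> / M\<bar> \<le> 2 * D / N"
proof -
  have l: "l > 0" using assms mult_pos_pos[of N M] by linarith
  have "D * M \<ge> 0" using assms(1) by linarith
  have "\<bar>S * M - \<Gamma> * l\<bar> = \<bar>(S - N * \<Gamma>) * M + \<Gamma> * (N * M - l)\<bar>"
    by (simp add: algebra_simps)
  also have "\<dots> \<le> \<bar>S - N * \<Gamma>\<bar> * M + \<bar>\<Gamma>\<bar> * \<bar>N * M - l\<bar>"
    using \<open>M > 0\<close> by (metis abs_mult abs_of_pos abs_triangle_ineq)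
  also have "\<dots> \<le> (D * M) * M + M * (D * M)"
    using assms \<open>D * M \<ge> 0\<close>
    by (intro add_mono mult_mono mult_right_mono) (auto simp: distrib_right)
  finally have "\<bar>S * M - \<Gamma> * l\<bar> \<le> 2 * D * M * M" by simp
  moreover have "S / l - \<Gamma> / M = (S * M - \<Gamma> * l) / (l * M)"
    using l \<open>M > 0\<close> by (simp add: field_simps)
  moreover have "\<bar>(S * M - \<Gamma> * l) / (l * M)\<bar> = \<bar>S * M - \<Gamma> * l\<bar> / (l * M)"
    using l \<open>M > 0\<close> by (simp add: abs_mult)
  ultimately have "\<bar>S / l - \<Gamma> / M\<bar> \<le> 2 * D * M * M / (l * M)"
    using divide_right_mono[of "\<bar>S * M - \<Gamma> * l\<bar>" "2 * D * M * M" "l * M"] l \<open>M > 0\<close>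
    by (simp only:) simp
  also have "\<dots> \<le> 2 * D * M * M / (N * M * M)"
    using assms \<open>D * M \<ge> 0\<close> l by (intro divide_left_mono mult_right_mono mult_pos_pos) auto
  also have "\<dots> = 2 * D / N" using \<open>M > 0\<close> by simp
  finally show ?thesis .
qed

section \<open>Orbit segments joined into a periodic pseudo-orbit\<close>

context compact_system
begin

lemma chain_list_orbit_segment:
  assumes "x \<in> X" "N > 0" "dist ((T ^^ N) x) y < \<delta>"
  shows "chain_list X T \<delta> x (map (\<lambda>j. (T ^^ j) x) [0..<N]) y"
proof -
  have "\<delta> > 0" using assms(3) zero_le_dist[of "(T ^^ N) x" y] by linarith
  have "dist (T ((map (\<lambda>j. (T ^^ j) x) [0..<N] @ [y]) ! i)) ((map (\<lambda>j. (T ^^ j) x) [0..<N] @ [y]) ! Suc i) < \<delta>"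
    if "i < N" for i
  proof (cases "Suc i = N")
    case True
    then show ?thesis using assms(3) by (auto simp: nth_append)
  next
    case False
    then show ?thesis using that \<open>\<delta> > 0\<close> by (auto simp: nth_append)
  qed
  then show ?thesis
    using assms(1,2) funpow_in[OF assms(1)]
    by (auto simp: chain_list_def successively_conv_nth hd_map)
qed

text \<open>Lengths are bounded by using only chains between \<open>b\<close> and the centres of a
  finite cover. A chain into \<open>x\<close> arises by moving an endpoint; a chain out starts at a
  centre \<open>p\<close> near \<open>x\<close>, to which an orbit segment arriving at
  \<open>x\<close> can jump instead.\<close>

lemma uniform_connections:
  assumes K: "compact K" and conn: "\<And>x y \<delta>. x \<in> K \<Longrightarrow> y \<in> K \<Longrightarrow> \<delta> > 0 \<Longrightarrow> \<exists>l. chain_list X T \<delta> x l y"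
    and b: "b \<in> K" and "\<delta> > 0"
  shows "\<exists>L. \<forall>x\<in>K. (\<exists>l. chain_list X T \<delta> b l x \<and> length l \<le> L) \<and>
    (\<exists>p l. dist x p < \<delta> \<and> chain_list X T \<delta> p l b \<and> length l \<le> L)"
proof -
  have \<delta>2: "\<delta> / 2 > 0" using \<open>\<delta> > 0\<close> by simp
  obtain k where k: "finite k" "k \<subseteq> K" "K \<subseteq> (\<Union>x\<in>k. ball x (\<delta> / 2))"
    using seq_compact_imp_totally_bounded[OF compact_imp_seq_compact[OF K], rule_format, OF \<delta>2]
    by (elim exE conjE) (rule that)
  have "\<forall>p\<in>k. \<exists>l. chain_list X T (\<delta> / 2) b l p" "\<forall>p\<in>k. \<exists>l. chain_list X T \<delta> p l b"
    using k(2) b \<delta>2 \<open>\<delta> > 0\<close> by (auto intro!: conn)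
  then obtain l1 l2 where l1: "\<And>p. p \<in> k \<Longrightarrow> chain_list X T (\<delta> / 2) b (l1 p) p"
    and l2: "\<And>p. p \<in> k \<Longrightarrow> chain_list X T \<delta> p (l2 p) b" by metis
  define L where "L = (\<Sum>p\<in>k. length (l1 p) + length (l2 p))"
  show ?thesis
  proof (intro exI[of _ L] ballI)
    fix x assume "x \<in> K"
    then obtain p where p: "p \<in> k" "dist p x < \<delta> / 2" using k(3) by auto
    have "length (l1 p) + length (l2 p) \<le> L"
      unfolding L_def by (rule member_le_sum[OF p(1)]) (use k(1) in auto)
    moreover have "chain_list X T \<delta> b (l1 p) x"
      using chain_list_change_end[OF l1[OF p(1)] p(2)] by simp
    moreover have "dist x p < \<delta>" using p(2) \<open>\<delta> > 0\<close> by (simp add: dist_commute)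
    ultimately show "(\<exists>l. chain_list X T \<delta> b l x \<and> length l \<le> L) \<and>
        (\<exists>p l. dist x p < \<delta> \<and> chain_list X T \<delta> p l b \<and> length l \<le> L)"
      using l2[OF p(1)] by (meson add_leD1 add_leD2)
  qed
qed

text \<open>Each block runs from \<open>b\<close> by a chain to a sample point, follows its orbit
  for \<open>N\<close> steps and returns to \<open>b\<close>. The samples approximate the integral
  of the average \<open>G\<close>, which by invariance is that of \<open>g\<close>; the connections
  cost at most \<open>2 * L\<close> per block.\<close>

lemma integral_approx_periodic:
  assumes inv: "\<mu> \<in> invariant_measures X T" and K: "compact K" "K \<subseteq> X" "emeasure \<mu> K = 1" "T ` K \<subseteq> K"
    and conn: "\<And>x y \<delta>. x \<in> K \<Longrightarrow> y \<in> K \<Longrightarrow> \<delta> > 0 \<Longrightarrow> \<exists>l. chain_list X T \<delta> x l y"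
    and "\<epsilon> > 0" "\<delta> > 0"
  shows "\<exists>b l. chain_list X T \<delta> b l b \<and> (\<forall>g :: 'a \<Rightarrow> real. 1-lipschitz_on X g \<longrightarrow> (\<forall>x\<in>X. \<bar>g x\<bar> \<le> 1) \<longrightarrow>
    \<bar>integral\<^sup>L \<mu> g - (\<Sum>x\<leftarrow>l. g x) / length l\<bar> \<le> \<epsilon>)"
proof -
  note inv' = invariant_measureD[OF inv]
  have "K \<noteq> {}" using K(3) by auto
  then obtain b where b: "b \<in> K" by blast
  obtain L where L: "\<And>x. x \<in> K \<Longrightarrow> \<exists>l. chain_list X T \<delta> b l x \<and> length l \<le> L"
    "\<And>x. x \<in> K \<Longrightarrow> \<exists>p l. dist x p < \<delta> \<and> chain_list X T \<delta> p l b \<and> length l \<le> L"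
    using uniform_connections[OF K(1) conn b \<open>\<delta> > 0\<close>] by blast
  \<comment> \<open>With \<open>D = 2 * L\<close> the perturbation bound \<open>2 * D / N\<close> is
    \<open>4 * L / N\<close>, hence below \<open>\<epsilon> / 2\<close>.\<close>
  obtain N :: nat where N: "8 * real L / \<epsilon> < real N" using reals_Archimedean2 by blast
  have "0 \<le> 8 * real L / \<epsilon>" using \<open>\<epsilon> > 0\<close> by simp
  then have N0: "N > 0" using N by linarith
  have KN: "(T ^^ j) x \<in> K" if "x \<in> K" for x j
    using that K(4) by (induction j) auto
  have "\<exists>l. chain_list X T \<delta> b l b \<and> N \<le> length l \<and> length l \<le> N + 2 * L \<and>
      (\<forall>g. (\<forall>x\<in>X. \<bar>g x\<bar> \<le> 1) \<longrightarrow> \<bar>(\<Sum>y\<leftarrow>l. g y) - (\<Sum>j<N. g ((T ^^ j) x))\<bar> \<le> 2 * real L)"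
    if x: "x \<in> K" for x
  proof -
    obtain l1 where l1: "chain_list X T \<delta> b l1 x" "length l1 \<le> L" using L(1)[OF x] by blast
    obtain p l2 where l2: "dist ((T ^^ N) x) p < \<delta>" "chain_list X T \<delta> p l2 b" "length l2 \<le> L"
      using L(2)[OF KN[OF x]] by blast
    let ?s = "map (\<lambda>j. (T ^^ j) x) [0..<N]"
    have "chain_list X T \<delta> x ?s p" using x K(2) by (intro chain_list_orbit_segment N0 l2) auto
    then have "chain_list X T \<delta> b (l1 @ ?s @ l2) b"
      by (intro chain_list_append[OF l1(1)] chain_list_append[OF _ l2(2)])
    moreover have "\<bar>(\<Sum>y\<leftarrow>l1 @ ?s @ l2. g y) - (\<Sum>j<N. g ((T ^^ j) x))\<bar> \<le> 2 * real L"
      if g: "\<forall>x\<in>X. \<bar>g x\<bar> \<le> 1" for g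
    proof -
      have "\<bar>\<Sum>y\<leftarrow>l1. g y\<bar> \<le> length l1" "\<bar>\<Sum>y\<leftarrow>l2. g y\<bar> \<le> length l2"
        using g l1(1) l2(2) by (auto intro!: abs_sum_list_le_length simp: chain_list_def)
      moreover have "(\<Sum>y\<leftarrow>?s. g y) = (\<Sum>j<N. g ((T ^^ j) x))"
        by (simp add: comp_def interv_sum_list_conv_sum_set_nat atLeast0LessThan)
      ultimately show ?thesis using l1(2) l2(3) by simp
    qed
    ultimately show ?thesis
      using l1(2) l2(3) by (intro exI[of _ "l1 @ ?s @ l2"]) auto
  qed
  then obtain block where block: "\<And>x. x \<in> K \<Longrightarrow> chain_list X T \<delta> b (block x) b"
    "\<And>x. x \<in> K \<Longrightarrow> N \<le> length (block x)" "\<And>x. x \<in> K \<Longrightarrow> length (block x) \<le> N + 2 * L"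
    "\<And>x g. x \<in> K \<Longrightarrow> (\<forall>x\<in>X. \<bar>g x\<bar> \<le> 1) \<Longrightarrow>
      \<bar>(\<Sum>y\<leftarrow>block x. g y) - (\<Sum>j<N. g ((T ^^ j) x))\<bar> \<le> 2 * real L"
    by metis
  \<comment> \<open>At scale \<open>\<rho>\<close> the average over \<open>N\<close> steps of any
    1-Lipschitz function oscillates by at most \<open>\<epsilon> / 4\<close>. The sample list can
    therefore be chosen before \<open>g\<close>.\<close>
  obtain \<rho> where \<rho>: "\<rho> > 0" "\<And>r x y. r < N \<Longrightarrow> x \<in> X \<Longrightarrow> y \<in> X \<Longrightarrow> dist x y < \<rho> \<Longrightarrow>
      dist ((T ^^ r) x) ((T ^^ r) y) < \<epsilon> / 4"
    using funpow_uniformly_continuous[of "\<epsilon> / 4" N] \<open>\<epsilon> > 0\<close> by (metis divide_pos_pos zero_less_numeral)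
  have "\<epsilon> / 4 > 0" using \<open>\<epsilon> > 0\<close> by simp
  from integral_approx_average[OF inv'(1,2) compact_imp_closed[OF K(1)] K(2,3) \<rho>(1) this]
  obtain xs where xs: "xs \<noteq> []" "set xs \<subseteq> K" "\<And>g. continuous_on X g \<Longrightarrow> (\<forall>x\<in>X. \<bar>g x\<bar> \<le> 1) \<Longrightarrow>
    (\<forall>x\<in>K. \<forall>y\<in>K. dist x y < \<rho> \<longrightarrow> \<bar>g x - g y\<bar> \<le> \<epsilon> / 4) \<Longrightarrow>
    \<bar>integral\<^sup>L \<mu> g - (\<Sum>x\<leftarrow>xs. g x) / length xs\<bar> \<le> 2 * (\<epsilon> / 4)" by blast
  define l where "l = concat (map block xs)"
  have len: "real N * length xs \<le> length l" "length l \<le> (real N + 2 * real L) * length xs"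
  proof -
    have "N * length ys \<le> length (concat (map block ys)) \<and> length (concat (map block ys)) \<le> (N + 2 * L) * length ys"
      if "set ys \<subseteq> K" for ys
      using that
    proof (induction ys)
      case (Cons y ys)
      then show ?case using block(2)[of y] block(3)[of y] by simp
    qed simp
    from this[OF xs(2)] have "real (N * length xs) \<le> real (length l)"
      "real (length l) \<le> real ((N + 2 * L) * length xs)"
      unfolding l_def[symmetric] of_nat_le_iff by blast+
    then show "real N * length xs \<le> length l" "length l \<le> (real N + 2 * real L) * length xs"
      by simp_all
  qed
  have "chain_list X T \<delta> b l b"
    unfolding l_def using block(1) xs(2) by (intro chain_list_concat_loops xs(1)) auto
  moreover have "\<bar>integral\<^sup>L \<mu> g - (\<Sum>x\<leftarrow>l. g x) / length l\<bar> \<le> \<epsilon>"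
    if g: "1-lipschitz_on X g" and g1: "\<forall>x\<in>X. \<bar>g x\<bar> \<le> 1" for g
  proof -
    have gc: "continuous_on X g" by (rule lipschitz_on_continuous_on[OF g])
    define G where "G x = (\<Sum>j<N. g ((T ^^ j) x)) / real N" for x
    have NG: "real N * G x = (\<Sum>j<N. g ((T ^^ j) x))" for x
      using N0 by (simp add: G_def)
    have Gc: "continuous_on X G"
      unfolding G_def using N0 by (intro continuous_intros continuous_on_comp_funpow gc) simp
    have G1: "\<bar>G x\<bar> \<le> 1" if "x \<in> X" for x
    proof -
      have "\<bar>\<Sum>j<N. g ((T ^^ j) x)\<bar> \<le> (\<Sum>j<N. \<bar>g ((T ^^ j) x)\<bar>)" by (rule sum_abs)
      also have "\<dots> \<le> (\<Sum>j<N. 1)" using g1 funpow_in[OF that] by (intro sum_mono) auto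
      finally show ?thesis using N0 by (simp add: G_def divide_le_eq)
    qed
    have Gosc: "\<bar>G x - G y\<bar> \<le> \<epsilon> / 4" if "x \<in> K" "y \<in> K" "dist x y < \<rho>" for x y
    proof -
      have "real N * (G x - G y) = (\<Sum>j<N. g ((T ^^ j) x) - g ((T ^^ j) y))"
        by (simp add: right_diff_distrib NG sum_subtractf)
      also have "\<bar>\<dots>\<bar> \<le> (\<Sum>j<N. \<bar>g ((T ^^ j) x) - g ((T ^^ j) y)\<bar>)" by (rule sum_abs)
      also have "\<dots> \<le> (\<Sum>j<N. \<epsilon> / 4)"
      proof (rule sum_mono)
        fix j assume "j \<in> {..<N}"
        moreover have xy: "x \<in> X" "y \<in> X" using that K(2) by auto
        ultimately have "dist ((T ^^ j) x) ((T ^^ j) y) < \<epsilon> / 4" using that by (intro \<rho>(2)) auto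
        then show "\<bar>g ((T ^^ j) x) - g ((T ^^ j) y)\<bar> \<le> \<epsilon> / 4"
          using lipschitz_onD[OF g funpow_in[OF xy(1)] funpow_in[OF xy(2)], of j j]
          by (simp add: dist_real_def)
      qed
      finally have "real N * \<bar>G x - G y\<bar> \<le> real N * (\<epsilon> / 4)" by (simp add: abs_mult)
      then show ?thesis using N0 by (simp only: mult_le_cancel_left_pos of_nat_0_less_iff)
    qed
    have "integral\<^sup>L \<mu> G = integral\<^sup>L \<mu> g"
      unfolding G_def by (rule invariant_integral_average[OF inv gc N0])
    then have 1: "\<bar>integral\<^sup>L \<mu> g - (\<Sum>x\<leftarrow>xs. G x) / length xs\<bar> \<le> \<epsilon> / 2"
      using xs(3)[of G] Gc G1 Gosc by simp
    have "\<bar>(\<Sum>x\<leftarrow>l. g x) / length l - (\<Sum>x\<leftarrow>xs. G x) / length xs\<bar> \<le> 2 * (2 * real L) / real N"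
    proof (rule average_perturbation)
      show "\<bar>(\<Sum>x\<leftarrow>l. g x) - real N * (\<Sum>x\<leftarrow>xs. G x)\<bar> \<le> 2 * real L * real (length xs)"
        unfolding l_def using xs(2) block(4)[OF _ g1]
        by (intro sum_concat_blocks) (auto simp: NG)
      show "\<bar>\<Sum>x\<leftarrow>xs. G x\<bar> \<le> real (length xs)"
        using xs(2) K(2) by (intro abs_sum_list_le_length G1) auto
    qed (use len N0 xs(1) in auto)
    also have "\<dots> \<le> \<epsilon> / 2"
      using N N0 \<open>\<epsilon> > 0\<close> by (simp add: field_simps)
    finally show ?thesis using 1 by linarith
  qed
  ultimately show ?thesis by blast
qed

text \<open>The error splits into \<open>\<epsilon> / 2\<close> for the periodic pseudo-orbit,
  \<open>\<epsilon> / 10\<close> for following it, and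
  \<open>2 * e 0 \<le> 4 * (\<epsilon> / 10)\<close> for comparing the odometer measure with the
  average over the first period. As \<open>P 0 = length l\<close>, that average covers exactly one
  round of the loop.\<close>

lemma odometer_approximation:
  assumes shadow: "shadowing_property X T" and inv: "\<mu> \<in> invariant_measures X T"
    and conn: "\<And>x y \<delta>. x \<in> support X \<mu> \<Longrightarrow> y \<in> support X \<mu> \<Longrightarrow> \<delta> > 0 \<Longrightarrow> \<exists>l. chain_list X T \<delta> x l y"
    and "\<epsilon> > 0"
  shows "\<exists>\<nu>. ergodic_measure X T \<nu> \<and> supported_on_odometer X T \<nu> \<and>
    (\<forall>g :: 'a \<Rightarrow> real. 1-lipschitz_on X g \<longrightarrow> (\<forall>x\<in>X. \<bar>g x\<bar> \<le> 1) \<longrightarrow> \<bar>integral\<^sup>L \<nu> g - integral\<^sup>L \<mu> g\<bar> \<le> \<epsilon>)"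
proof -
  note supp = support_props[OF inv]
  have K: "compact (support X \<mu>)"
    using compact supp(1,2) closed_Int_compact[of "support X \<mu>" X] by (simp add: Int_absorb2)
  have eps: "\<epsilon> / 10 > 0" "\<epsilon> / 2 > 0" using \<open>\<epsilon> > 0\<close> by simp_all
  obtain \<delta> where "\<delta> > 0" and \<delta>: "\<And>q p. pseudo_orbit X T \<delta> q \<Longrightarrow> p > 0 \<Longrightarrow> (\<forall>i. q (i + p) = q i) \<Longrightarrow>
    \<exists>z P e. uniformly_recurrent X T z P e \<and> P 0 = p \<and> e 0 \<le> 2 * (\<epsilon> / 10) \<and>
      (\<forall>i. dist ((T ^^ i) z) (q i) \<le> \<epsilon> / 10)"
    using shadowing_uniformly_recurrent[OF shadow eps(1)] by blast
  obtain b l where l: "chain_list X T \<delta> b l b" and approx: "\<And>g. 1-lipschitz_on X g \<Longrightarrow> (\<forall>x\<in>X. \<bar>g x\<bar> \<le> 1) \<Longrightarrow>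
    \<bar>integral\<^sup>L \<mu> g - (\<Sum>x\<leftarrow>l. g x) / length l\<bar> \<le> \<epsilon> / 2"
    using integral_approx_periodic[OF inv K supp(2-4) conn eps(2) \<open>\<delta> > 0\<close>] by blast
  have l0: "length l > 0" and lX: "set l \<subseteq> X" using l by (auto simp: chain_list_def)
  obtain z P e where z: "uniformly_recurrent X T z P e" and P: "P 0 = length l" "e 0 \<le> 2 * (\<epsilon> / 10)"
    "\<And>i. dist ((T ^^ i) z) (l ! (i mod length l)) \<le> \<epsilon> / 10"
    using \<delta>[OF loop_pseudo_orbit[OF l] l0] by auto
  interpret U: uniformly_recurrent X T z P e by (rule z)
  have "\<bar>integral\<^sup>L U.odometer_measure g - integral\<^sup>L \<mu> g\<bar> \<le> \<epsilon>"
    if g: "1-lipschitz_on X g" and g1: "\<forall>x\<in>X. \<bar>g x\<bar> \<le> 1" for g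
  proof -
    have "\<bar>integral\<^sup>L U.odometer_measure g - U.average 0 g z\<bar> \<le> 4 * (\<epsilon> / 10)"
      using U.odometer_measure_integral_close[OF g, of 0 0] P(2) by simp
    moreover have "\<bar>U.average 0 g z - (\<Sum>x\<leftarrow>l. g x) / length l\<bar> \<le> \<epsilon> / 10"
    proof -
      have "(\<Sum>x\<leftarrow>l. g x) = (\<Sum>i<length l. g (l ! i))"
        by (simp add: sum_list_sum_nth atLeast0LessThan)
      then have "\<bar>(\<Sum>i<length l. g ((T ^^ i) z)) - (\<Sum>x\<leftarrow>l. g x)\<bar>
          = \<bar>\<Sum>i<length l. g ((T ^^ i) z) - g (l ! i)\<bar>"
        by (simp add: sum_subtractf)
      also have "\<dots> \<le> (\<Sum>i<length l. \<bar>g ((T ^^ i) z) - g (l ! i)\<bar>)" by (rule sum_abs)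
      also have "\<dots> \<le> (\<Sum>i<length l. \<epsilon> / 10)"
      proof (rule sum_mono)
        fix i assume i: "i \<in> {..<length l}"
        then have "l ! i \<in> X" using lX nth_mem by blast
        with lipschitz_onD[OF g funpow_in[OF U.z] this, of i] P(3)[of i] i
        show "\<bar>g ((T ^^ i) z) - g (l ! i)\<bar> \<le> \<epsilon> / 10"
          by (simp add: dist_real_def)
      qed
      finally have "\<bar>(\<Sum>i<length l. g ((T ^^ i) z)) - (\<Sum>x\<leftarrow>l. g x)\<bar> \<le> \<epsilon> / 10 * length l"
        by (simp add: mult.commute)
      then show ?thesis
        using l0 unfolding P(1) by (simp add: diff_divide_distrib[symmetric] abs_divide pos_divide_le_eq)
    qed
    ultimately show ?thesis using approx[OF g g1] by linarith
  qed
  then show ?thesis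
    using U.odometer_measure_ergodic U.supported_on_odometer_measure by blast
qed

end

section \<open>Approximation in the bounded Lipschitz metric\<close>

lemma chain_related_imp_chain_list:
  assumes "chain_related X T a x" "chain_related X T a y" "\<delta> > 0"
  shows "\<exists>l. chain_list X T \<delta> x l y"
proof -
  obtain n c where "chain X T \<delta> n c x a" using assms unfolding chain_related_def by blast
  moreover obtain n' c' where "chain X T \<delta> n' c' a y" using assms unfolding chain_related_def by blast
  ultimately show ?thesis using chain_list_append[OF chain_imp_chain_list chain_imp_chain_list] by blast
qed

text \<open>Both norms are nonnegative, so each is at most 1. The Lipschitz norm is an infimum: it
  supplies constants below \<open>1 + \<eta>\<close> for every \<open>\<eta> > 0\<close>, and the
  constant 1 follows in the limit.\<close>

lemma BL_ball_props:
  assumes X: "X \<noteq> {}" "compact X" and g: "g \<in> BL_ball X"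
  shows "1-lipschitz_on X g" "\<forall>x\<in>X. \<bar>g x\<bar> \<le> 1"
proof -
  obtain L where L: "L-lipschitz_on X g" and norm: "sup_norm X g + lipschitz_norm X g \<le> 1"
    using g by (auto simp: BL_ball_def)
  have "bounded (g ` X)"
    by (rule compact_imp_bounded[OF compact_continuous_image[OF lipschitz_on_continuous_on[OF L] X(2)]])
  then obtain B where "\<And>x. x \<in> X \<Longrightarrow> \<bar>g x\<bar> \<le> B" by (auto simp: bounded_iff)
  then have bdd: "bdd_above ((\<lambda>x. \<bar>g x\<bar>) ` X)" by (auto simp: bdd_above_def)
  have sup: "\<bar>g x\<bar> \<le> sup_norm X g" if "x \<in> X" for x
    unfolding sup_norm_def by (rule cSUP_upper[OF that bdd])
  let ?S = "{L. L-lipschitz_on X g}"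
  have ne: "?S \<noteq> {}" using L by blast
  have lip0: "lipschitz_norm X g \<ge> 0"
    unfolding lipschitz_norm_def by (rule cInf_greatest[OF ne]) (auto intro: lipschitz_on_nonneg)
  show "\<forall>x\<in>X. \<bar>g x\<bar> \<le> 1" using sup lip0 norm by fastforce
  have "sup_norm X g \<ge> 0" using X(1) sup abs_ge_zero order_trans by blast
  then have "Inf ?S \<le> 1" using norm by (simp add: lipschitz_norm_def)
  show "1-lipschitz_on X g"
  proof (rule lipschitz_onI)
    fix x y assume xy: "x \<in> X" "y \<in> X"
    have "dist (g x) (g y) \<le> (1 + \<eta>) * dist x y" if "\<eta> > 0" for \<eta>
    proof -
      have "Inf ?S < 1 + \<eta>" using \<open>Inf ?S \<le> 1\<close> that by simp
      then obtain L' where L': "L'-lipschitz_on X g" "L' < 1 + \<eta>" using cInf_lessD[OF ne] by blast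
      then show ?thesis
        using lipschitz_onD[OF L'(1) xy] mult_right_mono[of L' "1 + \<eta>" "dist x y"] by simp
    qed
    then have "dist (g x) (g y) - dist x y \<le> \<eta> * dist x y" if "\<eta> > 0" for \<eta>
      using that by (simp add: algebra_simps)
    note * = this
    have "dist (g x) (g y) - dist x y \<le> 0"
    proof (rule LIMSEQ_le_const)
      show "(\<lambda>n. inverse (real (Suc n)) * dist x y) \<longlonglongrightarrow> 0"
        by (rule tendsto_mult_left_zero[OF LIMSEQ_inverse_real_of_nat])
    qed (use * in auto)
    then show "dist (g x) (g y) \<le> 1 * dist x y" by simp
  qed simp
qed

theorem theorem3p4:
  fixes X :: "'a::metric_space set" and T :: "'a \<Rightarrow> 'a"
    and f :: "nat \<Rightarrow> 'a \<Rightarrow> real" and \<mu> :: "'a measure"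
  assumes "dynamical_system X T"
    and "shadowing_property X T"
    and "dense_sequence_BL X f"
    and "\<mu> \<in> invariant_measures X T"
    and "\<exists>C\<in>chain_recurrent_classes X T. support X \<mu> \<subseteq> C"
  shows "\<forall>\<epsilon>>0. \<exists>\<nu>. ergodic_measure X T \<nu> \<and> supported_on_odometer X T \<nu> \<and> d_BL f \<nu> \<mu> < \<epsilon>"
proof (intro allI impI)
  fix \<epsilon> :: real assume "\<epsilon> > 0"
  interpret compact_system X T by standard (rule assms(1))
  have "space \<mu> = X" "prob_space \<mu>" using invariant_measureD[OF assms(4)] by simp_all
  then have ne: "X \<noteq> {}" using prob_space.not_empty by blast
  obtain a where a: "support X \<mu> \<subseteq> {y. chain_related X T a y}"
    using assms(5) by (auto simp: chain_recurrent_classes_def quotient_def)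
  have conn: "\<exists>l. chain_list X T \<delta> x l y" if "x \<in> support X \<mu>" "y \<in> support X \<mu>" "\<delta> > 0" for x y \<delta>
    by (rule chain_related_imp_chain_list[of X T a]) (use that a in auto)
  have "\<epsilon> / 2 > 0" using \<open>\<epsilon> > 0\<close> by simp
  from odometer_approximation[OF assms(2,4) conn this]
  obtain \<nu> where \<nu>: "ergodic_measure X T \<nu>" "supported_on_odometer X T \<nu>"
    and close: "\<And>g. 1-lipschitz_on X g \<Longrightarrow> (\<forall>x\<in>X. \<bar>g x\<bar> \<le> 1) \<Longrightarrow> \<bar>integral\<^sup>L \<nu> g - integral\<^sup>L \<mu> g\<bar> \<le> \<epsilon> / 2"
    by blast
  have "f n \<in> BL_ball X" for n using assms(3) by (simp add: dense_sequence_BL_def)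
  then have fn: "\<bar>integral\<^sup>L \<nu> (f n) - integral\<^sup>L \<mu> (f n)\<bar> \<le> \<epsilon> / 2" for n
    by (intro close BL_ball_props ne compact)
  \<comment> \<open>The weights sum to 1, so the uniform bound \<open>\<epsilon> / 2\<close> on the
    terms carries over to \<open>d_BL\<close>; the halving makes the final inequality
    strict.\<close>
  have half: "(\<lambda>n. (1 / 2) ^ Suc n * (\<epsilon> / 2)) sums (1 * (\<epsilon> / 2))"
    by (rule sums_mult2[OF power_half_series])
  have le: "(1 / 2) ^ Suc n * \<bar>integral\<^sup>L \<nu> (f n) - integral\<^sup>L \<mu> (f n)\<bar> \<le> (1 / 2) ^ Suc n * (\<epsilon> / 2)" for n
    by (rule mult_left_mono[OF fn]) simp
  have "summable (\<lambda>n. (1 / 2) ^ Suc n * \<bar>integral\<^sup>L \<nu> (f n) - integral\<^sup>L \<mu> (f n)\<bar>)"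
    by (rule summable_comparison_test'[OF sums_summable[OF half], of 0]) (use le in \<open>simp add: abs_mult\<close>)
  then have "d_BL f \<nu> \<mu> \<le> (\<Sum>n. (1 / 2) ^ Suc n * (\<epsilon> / 2))"
    unfolding d_BL_def by (intro suminf_le le sums_summable[OF half])
  also have "\<dots> < \<epsilon>" using sums_unique[OF half] \<open>\<epsilon> > 0\<close> by simp
  finally show "\<exists>\<nu>. ergodic_measure X T \<nu> \<and> supported_on_odometer X T \<nu> \<and> d_BL f \<nu> \<mu> < \<epsilon>"
    using \<nu> by blast
qed

end
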